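(* Let $f:[0,1]\to[0,1]$ be a Lebesgue-measure-preserving map that is piecewise continuously differentiable with finitely many pieces, and let $\mu=\mu_f$ be the permuton induced by $f$. Then $$\lim_{n\to\infty}\frac{H_n(\mu)}{n}=\int_0^1\log|f'(x)|\,dx.$$
   Context: A permuton is a Borel probability measure on $[0,1]^2$ with uniform marginals. For a map $f:[0,1]\to[0,1]$ preserving the Lebesgue measure $\lambda$, the permuton $\mu_f$ is defined by $\mu_f(A\times B)=\lambda(A\cap f^{-1}(B))$. Piecewise continuously differentiable with finitely many pieces means that $[0,1]$ can be partitioned into finitely many intervals on the interior of each of which $f$ is continuously differentiable ($|f'|$ is allowed to be unbounded near the endpoints of the pieces; $f$ need not be continuous at the endpoints). For a permuton $\mu$ and $n\ge 1$, draw $n$ i.i.d. points from $\mu$ and read the relative order of their heights from left to right; this gives a random permutation whose distribution on $\mathrm{Sym}(n)$ is denoted $\mu^{(n)}$, and $H_n(\mu)$ is the Shannon entropy of $\mu^{(n)}$ (natural logarithm). *)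

theory Defs
  imports "HOL-Probability.Probability" "HOL-Combinatorics.Permutations" "HOL-Library.Disjoint_Sets"
begin

section \<open>Measure-preserving piecewise smooth interval maps\<close>

definition unit_lebesgue :: "real measure" where
  "unit_lebesgue = restrict_space lborel {0..1}"

text \<open>
  Membership in the measurable functions includes \<open>f x \<in> {0..1}\<close> for \<open>x \<in> {0..1}\<close>.  Values of \<open>f\<close>
  outside \<open>{0..1}\<close> are never used.  Requiring Borel measurability loses nothing here: a piecewise
  continuous map with finitely many pieces is Borel.
\<close>
definition lebesgue_preserving :: "(real \<Rightarrow> real) \<Rightarrow> bool" where
  "lebesgue_preserving f \<longleftrightarrow>
     f \<in> unit_lebesgue \<rightarrow>\<^sub>M unit_lebesgue \<and> distr unit_lebesgue unit_lebesgue f = unit_lebesgue"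

text \<open>
  The library predicate \<open>piecewise_C1_differentiable_on\<close> is a different notion: it asks for
  continuity on the whole interval.  Degenerate pieces (single points) are allowed.
\<close>
definition finitely_piecewise_C1 :: "(real \<Rightarrow> real) \<Rightarrow> bool" where
  "finitely_piecewise_C1 f \<longleftrightarrow>
     (\<exists>P. finite P \<and> partition_on {0..1} P \<and>
          (\<forall>I\<in>P. is_interval I \<and> f C1_differentiable_on (interior I)))"


section \<open>Permutons\<close>

abbreviation borel_square :: "(real \<times> real) measure" where
  "borel_square \<equiv> restrict_space borel ({0..1} \<times> {0..1})"

definition permuton :: "(real \<times> real) measure \<Rightarrow> bool" where
  "permuton \<mu> \<longleftrightarrow> prob_space \<mu> \<and> sets \<mu> = sets borel_square \<and>
     distr \<mu> unit_lebesgue fst = unit_lebesgue \<and> distr \<mu> unit_lebesgue snd = unit_lebesgue"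

text \<open>The image of Lebesgue measure on the graph of \<open>f\<close>; see \<open>permuton_of_rectangle\<close> below.\<close>
definition permuton_of :: "(real \<Rightarrow> real) \<Rightarrow> (real \<times> real) measure" where
  "permuton_of f = distr unit_lebesgue borel_square (\<lambda>x. (x, f x))"


section \<open>Random permutations sampled from a permuton\<close>

text \<open>
  The rank of \<open>z i\<close> among \<open>z 1, \<dots>, z n\<close>.  Ties, which have probability 0 for the coordinates of
  points drawn from a permuton, are broken by the index, so that ranks are always a permutation.
\<close>
definition rank_of :: "nat \<Rightarrow> (nat \<Rightarrow> real) \<Rightarrow> nat \<Rightarrow> nat" where
  "rank_of n z i = card {k \<in> {1..n}. z k < z i \<or> (z k = z i \<and> k \<le> i)}"

text \<open>The \<open>j\<close>-th point from the left has the \<open>sampled_perm n p j\<close>-th smallest height.\<close>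
definition sampled_perm :: "nat \<Rightarrow> (nat \<Rightarrow> real \<times> real) \<Rightarrow> nat \<Rightarrow> nat" where
  "sampled_perm n p j =
     (if j \<in> {1..n}
      then rank_of n (\<lambda>i. snd (p i)) (inv_into {1..n} (rank_of n (\<lambda>i. fst (p i))) j)
      else j)"

abbreviation Sym :: "nat \<Rightarrow> (nat \<Rightarrow> nat) set" where
  "Sym n \<equiv> {\<sigma>. \<sigma> permutes {1..n}}"

text \<open>The law \<open>\<mu>\<^sup>(\<^sup>n\<^sup>)\<close> of the permutation sampled from \<open>n\<close> independent points with law \<open>\<mu>\<close>.\<close>
definition perm_law :: "nat \<Rightarrow> (real \<times> real) measure \<Rightarrow> (nat \<Rightarrow> nat) measure" where
  "perm_law n \<mu> = distr (\<Pi>\<^sub>M i\<in>{1..n}. \<mu>) (count_space (Sym n)) (sampled_perm n)"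

text \<open>The explicit sum is \<open>permuton_entropy_eq\<close> below.\<close>
definition permuton_entropy :: "nat \<Rightarrow> (real \<times> real) measure \<Rightarrow> real" where
  "permuton_entropy n \<mu> =
     prob_space.entropy (perm_law n \<mu>) (exp 1) (count_space (Sym n)) (\<lambda>\<sigma>. \<sigma>)"


section \<open>Basic properties\<close>

lemma space_unit_lebesgue [simp]: "space unit_lebesgue = {0..1}"
  by (simp add: unit_lebesgue_def space_restrict_space)

lemma sets_unit_lebesgue: "sets unit_lebesgue = sets (restrict_space borel {0..1})"
  by (simp add: unit_lebesgue_def sets_restrict_space)

lemma prob_space_unit_lebesgue: "prob_space unit_lebesgue"
  by (rule prob_spaceI)
     (simp add: unit_lebesgue_def space_restrict_space emeasure_restrict_space)

lemma measurable_graph: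
  assumes "f \<in> unit_lebesgue \<rightarrow>\<^sub>M unit_lebesgue"
  shows "(\<lambda>x. (x, f x)) \<in> unit_lebesgue \<rightarrow>\<^sub>M borel_square"
proof -
  have m: "unit_lebesgue \<rightarrow>\<^sub>M unit_lebesgue = unit_lebesgue \<rightarrow>\<^sub>M restrict_space borel {0..1}"
    by (rule measurable_cong_sets) (simp_all add: sets_unit_lebesgue)
  have 1: "f \<in> borel_measurable unit_lebesgue"
    using assms unfolding m by (simp add: measurable_restrict_space2_iff)
  have 2: "(\<lambda>x. x) \<in> borel_measurable unit_lebesgue"
    unfolding unit_lebesgue_def by (simp add: measurable_restrict_space1)
  have "f x \<in> {0..1}" if "x \<in> {0..1}" for x
    using measurable_space[OF assms, of x] that by simp
  then show ?thesis
    using borel_measurable_Pair[OF 2 1]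
    by (intro measurable_restrict_space2) auto
qed

lemma measurable_proj:
  shows "fst \<in> borel_square \<rightarrow>\<^sub>M unit_lebesgue" "snd \<in> borel_square \<rightarrow>\<^sub>M unit_lebesgue"
proof -
  have m: "borel_square \<rightarrow>\<^sub>M unit_lebesgue = borel_square \<rightarrow>\<^sub>M restrict_space borel {0..1}"
    by (rule measurable_cong_sets) (simp_all add: sets_unit_lebesgue)
  have "fst \<in> borel_measurable (borel :: (real \<times> real) measure)"
       "snd \<in> borel_measurable (borel :: (real \<times> real) measure)"
    by (auto intro!: borel_measurable_continuous_onI continuous_intros)
  then show "fst \<in> borel_square \<rightarrow>\<^sub>M unit_lebesgue" "snd \<in> borel_square \<rightarrow>\<^sub>M unit_lebesgue"
    unfolding m
    by (intro measurable_restrict_space2 measurable_restrict_space1;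
        force simp: space_restrict_space)+
qed

lemma permuton_permuton_of:
  assumes "lebesgue_preserving f"
  shows "permuton (permuton_of f)"
proof -
  have f: "f \<in> unit_lebesgue \<rightarrow>\<^sub>M unit_lebesgue"
    and p: "distr unit_lebesgue unit_lebesgue f = unit_lebesgue"
    using assms by (auto simp: lebesgue_preserving_def)
  note g = measurable_graph[OF f]
  have "prob_space (permuton_of f)"
    unfolding permuton_of_def by (rule prob_space.prob_space_distr[OF prob_space_unit_lebesgue g])
  then show ?thesis
    using p by (simp add: permuton_def permuton_of_def distr_distr[OF measurable_proj(1) g]
        distr_distr[OF measurable_proj(2) g] comp_def distr_id2)
qed

lemma permuton_of_rectangle:
  assumes f: "lebesgue_preserving f" and A: "A \<in> sets unit_lebesgue" and B: "B \<in> sets unit_lebesgue"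
  shows "emeasure (permuton_of f) (A \<times> B) = emeasure lborel (A \<inter> f -` B)"
proof -
  have f': "f \<in> unit_lebesgue \<rightarrow>\<^sub>M unit_lebesgue"
    using f by (auto simp: lebesgue_preserving_def)
  note g = measurable_graph[OF f']
  have sub: "A \<subseteq> {0..1}" "B \<subseteq> {0..1}"
    using sets.sets_into_space[OF A] sets.sets_into_space[OF B] by simp_all
  have "A \<times> B = (fst -` A \<inter> space borel_square) \<inter> (snd -` B \<inter> space borel_square)"
    using sub by (auto simp: space_restrict_space)
  then have AB: "A \<times> B \<in> sets borel_square"
    using measurable_sets[OF measurable_proj(1) A] measurable_sets[OF measurable_proj(2) B]
    by (metis sets.Int)
  have "emeasure (permuton_of f) (A \<times> B) = emeasure unit_lebesgue (A \<inter> f -` B)"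
    unfolding permuton_of_def using sub
    by (subst emeasure_distr[OF g AB]) (auto intro!: arg_cong[where f = "emeasure _"])
  also have "\<dots> = emeasure lborel (A \<inter> f -` B)"
    using sub unfolding unit_lebesgue_def by (subst emeasure_restrict_space) auto
  finally show ?thesis .
qed

lemma bij_rank_of: "bij_betw (rank_of n z) {1..n} {1..n}"
proof -
  define R where "R i = {k \<in> {1..n}. z k < z i \<or> (z k = z i \<and> k \<le> i)}" for i
  have r: "rank_of n z i = card (R i)" for i
    by (simp add: rank_of_def R_def)
  have less: "card (R i) < card (R j)"
    if "i \<in> {1..n}" "j \<in> {1..n}" "z i < z j \<or> (z i = z j \<and> i < j)" for i j
  proof (rule psubset_card_mono)
    show "finite (R j)" by (simp add: R_def)
    have "R i \<subseteq> R j" "j \<in> R j" "j \<notin> R i" using that by (auto simp: R_def)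
    then show "R i \<subset> R j" by auto
  qed
  have inj: "inj_on (rank_of n z) {1..n}"
  proof (rule inj_onI)
    fix i j assume a: "i \<in> {1..n}" "j \<in> {1..n}" "rank_of n z i = rank_of n z j"
    then show "i = j"
      using less[of i j] less[of j i] unfolding r
      by (metis linorder_less_linear order_less_irrefl)
  qed
  have "rank_of n z ` {1..n} \<subseteq> {1..n}"
  proof (rule image_subsetI)
    fix i assume i: "i \<in> {1..n}"
    have "i \<in> R i" "R i \<subseteq> {1..n}" "finite (R i)" using i by (auto simp: R_def)
    then show "rank_of n z i \<in> {1..n}"
      unfolding r using card_mono[of "{1..n}" "R i"] card_gt_0_iff[of "R i"] by auto
  qed
  then have "rank_of n z ` {1..n} = {1..n}"
    using inj by (simp add: endo_inj_surj)
  with inj show ?thesis by (simp add: bij_betw_def)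
qed

lemma sampled_perm_permutes: "sampled_perm n p permutes {1..n}"
proof (rule bij_imp_permutes)
  have "bij_betw (rank_of n (\<lambda>i. snd (p i)) \<circ> inv_into {1..n} (rank_of n (\<lambda>i. fst (p i))))
          {1..n} {1..n}"
    by (rule bij_betw_trans[OF bij_betw_inv_into[OF bij_rank_of] bij_rank_of])
  then show "bij_betw (sampled_perm n p) {1..n} {1..n}"
    by (rule bij_betw_cong[THEN iffD1, rotated]) (simp add: sampled_perm_def)
qed (auto simp: sampled_perm_def)

lemma sampled_perm_rank:
  assumes "i \<in> {1..n}"
  shows "sampled_perm n p (rank_of n (\<lambda>i. fst (p i)) i) = rank_of n (\<lambda>i. snd (p i)) i"
  using assms bij_rank_of[of n "\<lambda>i. fst (p i)"]
  by (auto simp: sampled_perm_def bij_betw_def inv_into_f_f)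

lemma sampled_perm_eq_iff:
  assumes "\<sigma> permutes {1..n}"
  shows "sampled_perm n p = \<sigma> \<longleftrightarrow>
    (\<forall>i\<in>{1..n}. \<sigma> (rank_of n (\<lambda>i. fst (p i)) i) = rank_of n (\<lambda>i. snd (p i)) i)"
proof
  assume R: "\<forall>i\<in>{1..n}. \<sigma> (rank_of n (\<lambda>i. fst (p i)) i) = rank_of n (\<lambda>i. snd (p i)) i"
  show "sampled_perm n p = \<sigma>"
  proof
    fix j show "sampled_perm n p j = \<sigma> j"
    proof (cases "j \<in> {1..n}")
      case True
      then obtain i where "i \<in> {1..n}" "j = rank_of n (\<lambda>i. fst (p i)) i"
        using bij_rank_of[of n "\<lambda>i. fst (p i)"] unfolding bij_betw_def by (metis imageE)
      then show ?thesis using R sampled_perm_rank[of i n p] by simp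
    next
      case False
      then show ?thesis using permutes_not_in[OF assms] by (auto simp: sampled_perm_def)
    qed
  qed
qed (use sampled_perm_rank in blast)

lemma finite_Sym: "finite (Sym n)"
  by (rule finite_permutations) simp

lemma measurable_rank_of:
  assumes "\<And>i. i \<in> {1..n} \<Longrightarrow> (\<lambda>p. z p i) \<in> borel_measurable M" and "i \<in> {1..n}"
  shows "(\<lambda>p. rank_of n (z p) i) \<in> M \<rightarrow>\<^sub>M count_space UNIV"
proof -
  have "rank_of n (z p) i =
      (\<Sum>k\<in>{1..n}. if z p k < z p i \<or> (z p k = z p i \<and> k \<le> i) then 1 else 0)" for p
    by (simp add: rank_of_def sum.If_cases Int_def)
  moreover have "(\<lambda>p. if z p k < z p i \<or> (z p k = z p i \<and> k \<le> i) then 1 else 0 :: nat)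
      \<in> M \<rightarrow>\<^sub>M count_space UNIV" if "k \<in> {1..n}" for k
  proof -
    note [measurable] = assms(1)[OF that] assms(1)[OF assms(2)]
    show ?thesis by measurable
  qed
  ultimately show ?thesis by (simp add: measurable_sum_nat)
qed

lemma measurable_sampled_perm:
  assumes "sets \<mu> = sets borel_square"
  shows "sampled_perm n \<in> (\<Pi>\<^sub>M i\<in>{1..n}. \<mu>) \<rightarrow>\<^sub>M count_space (Sym n)"
proof -
  let ?M = "\<Pi>\<^sub>M i\<in>{1..n}. \<mu>"
  have proj: "fst \<in> borel_measurable \<mu>" "snd \<in> borel_measurable \<mu>"
    unfolding measurable_cong_sets[OF assms refl]
    by (auto intro!: measurable_restrict_space1 borel_measurable_continuous_onI continuous_intros)
  have comp: "(\<lambda>p. p i) \<in> ?M \<rightarrow>\<^sub>M \<mu>" if "i \<in> {1..n}" for i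
    using that by measurable
  have x: "(\<lambda>p. rank_of n (\<lambda>i. fst (p i)) i) \<in> ?M \<rightarrow>\<^sub>M count_space UNIV"
    and y: "(\<lambda>p. rank_of n (\<lambda>i. snd (p i)) i) \<in> ?M \<rightarrow>\<^sub>M count_space UNIV" if "i \<in> {1..n}" for i
    using that measurable_compose[OF comp proj(1)] measurable_compose[OF comp proj(2)]
    by (auto intro!: measurable_rank_of)
  show ?thesis
    unfolding measurable_count_space_eq2[OF finite_Sym]
  proof safe
    fix p show "sampled_perm n p permutes {1..n}" by (rule sampled_perm_permutes)
  next
    fix \<sigma> assume s: "\<sigma> permutes {1..n}"
    have "sampled_perm n -` {\<sigma>} \<inter> space ?M = {p \<in> space ?M.
        \<forall>i\<in>{1..n}. \<sigma> (rank_of n (\<lambda>i. fst (p i)) i) = rank_of n (\<lambda>i. snd (p i)) i}"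
      using sampled_perm_eq_iff[OF s] by auto
    also have "\<dots> \<in> sets ?M"
    proof (rule sets.sets_Collect_finite_All)
      fix i assume i: "i \<in> {1..n}"
      note [measurable] = x[OF i] y[OF i]
      show "{p \<in> space ?M. \<sigma> (rank_of n (\<lambda>i. fst (p i)) i) = rank_of n (\<lambda>i. snd (p i)) i}
          \<in> sets ?M"
        by measurable
    qed simp
    finally show "sampled_perm n -` {\<sigma>} \<inter> space ?M \<in> sets ?M" .
  qed
qed

lemma prob_space_perm_law:
  assumes "permuton \<mu>"
  shows "prob_space (perm_law n \<mu>)"
proof -
  have "prob_space (\<Pi>\<^sub>M i\<in>{1..n}. \<mu>)"
    using assms by (intro prob_space_PiM) (auto simp: permuton_def)
  then show ?thesis
    unfolding perm_law_def using assms
    by (intro prob_space.prob_space_distr measurable_sampled_perm) (auto simp: permuton_def)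
qed

lemma permuton_entropy_eq:
  assumes "permuton \<mu>"
  shows "permuton_entropy n \<mu> =
    - (\<Sum>\<sigma>\<in>Sym n. measure (perm_law n \<mu>) {\<sigma>} * ln (measure (perm_law n \<mu>) {\<sigma>}))"
proof -
  let ?L = "perm_law n \<mu>"
  interpret L: prob_space ?L by (rule prob_space_perm_law[OF assms])
  interpret I: information_space ?L "exp 1" by unfold_locales simp
  have sp: "space ?L = Sym n" and st: "sets ?L = Pow (Sym n)"
    by (simp_all add: perm_law_def)
  have "simple_function ?L (\<lambda>\<sigma>. \<sigma>)"
    using finite_Sym st by (auto simp: simple_function_def sp)
  then have "simple_distributed ?L (\<lambda>\<sigma>. \<sigma>) (\<lambda>\<sigma>. measure ?L {\<sigma>})"
  proof (rule L.simple_distributedI)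
    fix \<sigma> assume "\<sigma> \<in> (\<lambda>\<sigma>. \<sigma>) ` space ?L"
    then have "(\<lambda>\<sigma>. \<sigma>) -` {\<sigma>} \<inter> space ?L = {\<sigma>}" by auto
    then show "measure ?L {\<sigma>} = measure ?L ((\<lambda>\<sigma>. \<sigma>) -` {\<sigma>} \<inter> space ?L)" by simp
  qed simp
  from I.entropy_simple_distributed[OF this] show ?thesis
    by (simp add: permuton_entropy_def sp log_def)
qed

end

theory Submission
  imports Defs
begin

text \<open>
  Measure preservation forces \<open>|f'| \<ge> 1\<close> inside every piece of \<open>f\<close>: a smaller derivative would
  compress an interval into one whose preimage is too small to contain it.  So \<open>f\<close> has finitely many
  branches, each strictly monotone, and almost every point is described by its height \<open>f x\<close>
  together with the label of its branch.  Given the height \<open>y\<close>, the point \<open>x\<close> over it has conditional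
  probability \<open>1 / |f' x|\<close>; hence \<open>\<integral> ln |f'|\<close> is the conditional entropy of the label given the
  height.  The permutation of a sample is, up to \<open>O(ln n)\<close> of entropy, the same as the word of
  labels read in the order of heights: this word determines the permutation, and conversely it can
  be recovered from the permutation and the numbers of points on the branches.

  The proof turns this into two instances of Gibbs' inequality, so that neither conditional
  entropies nor disintegrations appear.

  Lower bound (\<open>entropy_ge\<close>).  For a fixed permutation and a fixed word of labels from left to
  right, the map \<open>f \<times> \<dots> \<times> f\<close> is injective on the samples with these data
  (\<open>coordinates_determined\<close>).  By the change of variables formula its Jacobian
  \<open>|f' x\<^sub>1| \<dots> |f' x\<^sub>n|\<close> integrates to at most 1 there (\<open>nn_integral_jacobian_le_1\<close>).  The words from
  left to right are monotone, so there are at most \<open>(n + 1) ^ k\<close> of them, where \<open>k\<close> is the number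
  of branches (\<open>card_monotone_words\<close>).  Comparing the law of the permutation with the Jacobian gives
  \<open>H\<^sub>n \<ge> n \<integral> ln |f'| - k ln (n + 1)\<close> (\<open>shannon_entropy_ge_log_density\<close>).

  Upper bound (\<open>entropy_le\<close>).  Divide the range into cells of length \<open>1 / m\<close> and code a sample by its
  cells and labels in the order of heights, with weights \<open>v c t\<close> for the label \<open>t\<close> in the cell \<open>c\<close>.
  The cells form a monotone word, and \<open>shannon_entropy_le_code_length\<close> gives
  \<open>H\<^sub>n \<le> (m + 1) ln (n + 1) - n \<integral> ln (v (cell (f x)) (label x)) dx\<close>.  For \<open>v c t\<close> take the conditional
  probability of the branch \<open>t\<close> given the cell \<open>c\<close>.  The mean value theorem identifies its limit as
  \<open>1 / |f' x|\<close> for \<open>m \<rightarrow> \<infinity>\<close> (\<open>measure_piece_tendsto\<close>).  Adding a small \<open>\<delta>\<close> to the weights keeps their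
  logarithms bounded, so that dominated convergence applies (\<open>weight_tendsto\<close>).
\<close>

section \<open>Shannon entropy of a finite-valued random variable\<close>

definition shannon_entropy :: "'a measure \<Rightarrow> ('a \<Rightarrow> 'b) \<Rightarrow> 'b set \<Rightarrow> real" where
  "shannon_entropy M S V =
     - (\<Sum>v\<in>V. measure M (S -` {v} \<inter> space M) * ln (measure M (S -` {v} \<inter> space M)))"

context prob_space
begin

lemma expectation_finite_valued:
  fixes h :: "'b \<Rightarrow> real"
  assumes "finite V" and S: "S \<in> M \<rightarrow>\<^sub>M count_space V"
  shows "integrable M (\<lambda>x. h (S x))"
    and "expectation (\<lambda>x. h (S x)) = (\<Sum>v\<in>V. prob (S -` {v} \<inter> space M) * h v)"
proof -
  have ev: "S -` {v} \<inter> space M \<in> events" if "v \<in> V" for v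
    using measurable_sets[OF S, of "{v}"] that by simp
  have eq: "h (S x) = (\<Sum>v\<in>V. h v * indicator (S -` {v} \<inter> space M) x)" if "x \<in> space M" for x
  proof -
    have "S x \<in> V" using measurable_space[OF S that] by simp
    have "(\<Sum>v\<in>V. h v * indicator (S -` {v} \<inter> space M) x) = (\<Sum>v\<in>V. if v = S x then h v else 0)"
      using that by (intro sum.cong) (auto simp: indicator_def)
    then show ?thesis using \<open>S x \<in> V\<close> \<open>finite V\<close> by simp
  qed
  have int: "integrable M (\<lambda>x. \<Sum>v\<in>V. h v * indicator (S -` {v} \<inter> space M) x)"
    using ev by (intro Bochner_Integration.integrable_sum integrable_mult_right)
      (simp add: emeasure_eq_measure)
  show "integrable M (\<lambda>x. h (S x))"
    using int by (simp cong: Bochner_Integration.integrable_cong add: eq)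
  have "expectation (\<lambda>x. h (S x)) = expectation (\<lambda>x. \<Sum>v\<in>V. h v * indicator (S -` {v} \<inter> space M) x)"
    using eq by (intro Bochner_Integration.integral_cong) auto
  also have "\<dots> = (\<Sum>v\<in>V. h v * prob (S -` {v} \<inter> space M))"
    using ev by (subst Bochner_Integration.integral_sum) (auto simp: emeasure_eq_measure)
  finally show "expectation (\<lambda>x. h (S x)) = (\<Sum>v\<in>V. prob (S -` {v} \<inter> space M) * h v)"
    by (simp add: mult.commute)
qed

lemma sum_prob_finite_valued:
  assumes "finite V" and S: "S \<in> M \<rightarrow>\<^sub>M count_space V"
  shows "(\<Sum>v\<in>V. prob (S -` {v} \<inter> space M)) = 1"
  using expectation_finite_valued(2)[OF assms, of "\<lambda>_. 1"] by (simp add: prob_space)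

lemma shannon_entropy_eq_expectation:
  assumes "finite V" and S: "S \<in> M \<rightarrow>\<^sub>M count_space V"
  shows "shannon_entropy M S V = - expectation (\<lambda>x. ln (prob (S -` {S x} \<inter> space M)))"
  unfolding shannon_entropy_def
  by (subst expectation_finite_valued(2)[OF assms, of "\<lambda>v. ln (prob (S -` {v} \<inter> space M))"]) simp

lemma AE_finite_valued_positive_prob:
  assumes "finite V" and S: "S \<in> M \<rightarrow>\<^sub>M count_space V"
  shows "AE x in M. 0 < prob (S -` {S x} \<inter> space M)"
proof -
  have "AE x in M. S x \<noteq> v" if "v \<in> V" "prob (S -` {v} \<inter> space M) = 0" for v
    using that measurable_sets[OF S, of "{v}"]
    by (intro AE_I[of _ _ "S -` {v} \<inter> space M"]) (auto simp: emeasure_eq_measure)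
  then have "AE x in M. \<forall>v\<in>V. prob (S -` {v} \<inter> space M) = 0 \<longrightarrow> S x \<noteq> v"
    using \<open>finite V\<close> by (intro AE_finite_allI) auto
  then show ?thesis
    using AE_space
  proof eventually_elim
    case (elim x)
    have "S x \<in> V" using measurable_space[OF S] elim by simp
    then show ?case using elim by (auto simp: zero_less_measure_iff)
  qed
qed

text \<open>
  Gibbs' inequality against a density: if \<open>d\<close> has mass at most \<open>C\<close> on every fibre of \<open>S\<close>, then
  \<open>d\<close> times the probability of the fibre has total mass at most \<open>C\<close>, and \<open>ln t \<le> t - 1\<close> compares
  the logarithms.  With \<open>d\<close> the Jacobian of a map this bounds the entropy from below by the
  expected log-Jacobian, as soon as the map, with values in a probability space, is at most
  \<open>C\<close>-to-one on each fibre.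
\<close>
lemma shannon_entropy_ge_log_density:
  fixes d :: "'a \<Rightarrow> real"
  assumes V: "finite V" and S: "S \<in> M \<rightarrow>\<^sub>M count_space V"
    and d: "d \<in> borel_measurable M" and pos: "AE x in M. 0 < d x"
    and ld: "integrable M (\<lambda>x. ln (d x))"
    and C: "C > 0" "\<And>v. v \<in> V \<Longrightarrow> (\<integral>\<^sup>+x. ennreal (d x) * indicator (S -` {v} \<inter> space M) x \<partial>M) \<le> ennreal C"
  shows "shannon_entropy M S V \<ge> expectation (\<lambda>x. ln (d x)) - ln C"
proof -
  define p where "p v = prob (S -` {v} \<inter> space M)" for v
  have ev: "S -` {v} \<inter> space M \<in> events" if "v \<in> V" for v
    using measurable_sets[OF S, of "{v}"] that by simp
  note lp = expectation_finite_valued[OF V S, of "\<lambda>v. ln (p v)"]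
  have pm: "(\<lambda>x. p (S x)) \<in> borel_measurable M"
    using expectation_finite_valued(1)[OF V S, of p] by auto
  have "(\<integral>\<^sup>+x. ennreal (d x * p (S x) / C) \<partial>M)
      = (\<integral>\<^sup>+x. (\<Sum>v\<in>V. ennreal (p v / C) * (ennreal (d x) * indicator (S -` {v} \<inter> space M) x)) \<partial>M)"
  proof (rule nn_integral_cong_AE, use pos AE_space in eventually_elim)
    case (elim x)
    have "S x \<in> V" using measurable_space[OF S] elim by simp
    have "(\<Sum>v\<in>V. ennreal (p v / C) * (ennreal (d x) * indicator (S -` {v} \<inter> space M) x))
        = (\<Sum>v\<in>V. if v = S x then ennreal (p v / C) * ennreal (d x) else 0)"
      using elim by (intro sum.cong) (auto simp: indicator_def)
    also have "\<dots> = ennreal (p (S x) / C) * ennreal (d x)"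
      using \<open>S x \<in> V\<close> V by simp
    also have "\<dots> = ennreal (d x * p (S x) / C)"
      using elim C(1) by (simp add: ennreal_mult[symmetric] p_def mult.commute)
    finally show ?case by simp
  qed
  also have "\<dots> = (\<Sum>v\<in>V. ennreal (p v / C) * (\<integral>\<^sup>+x. ennreal (d x) * indicator (S -` {v} \<inter> space M) x \<partial>M))"
    using d ev by (subst nn_integral_sum) (auto intro!: sum.cong nn_integral_cmult)
  also have "\<dots> \<le> (\<Sum>v\<in>V. ennreal (p v / C) * ennreal C)"
    using C by (intro sum_mono mult_left_mono) auto
  also have "\<dots> = (\<Sum>v\<in>V. ennreal (p v))"
    using C(1) by (intro sum.cong) (auto simp: ennreal_mult[symmetric] p_def)
  also have "\<dots> = 1"
    using sum_prob_finite_valued[OF V S] by (simp add: p_def sum_ennreal)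
  finally have nn: "(\<integral>\<^sup>+x. ennreal (d x * p (S x) / C) \<partial>M) \<le> 1" .
  have nonneg: "AE x in M. 0 \<le> d x * p (S x) / C"
    using pos by eventually_elim (use C(1) in \<open>auto simp: p_def\<close>)
  have mp: "integrable M (\<lambda>x. d x * p (S x) / C)"
    using d pm nonneg nn by (intro integrableI_nonneg) (auto simp: less_top[symmetric] top_unique)
  have le1: "expectation (\<lambda>x. d x * p (S x) / C) \<le> 1"
    using nn nn_integral_eq_integral[OF mp nonneg] by simp
  have "expectation (\<lambda>x. ln (d x) + ln (p (S x)) - ln C) \<le> expectation (\<lambda>x. d x * p (S x) / C - 1)"
  proof (rule integral_mono_AE)
    show "AE x in M. ln (d x) + ln (p (S x)) - ln C \<le> d x * p (S x) / C - 1"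
      using pos AE_finite_valued_positive_prob[OF V S]
    proof eventually_elim
      case (elim x)
      have "ln (d x * p (S x) / C) \<le> d x * p (S x) / C - 1"
        using elim C(1) by (intro ln_le_minus_one) (simp add: p_def)
      then show ?case
        using elim C(1) by (simp add: ln_div ln_mult p_def)
    qed
  qed (use ld lp mp in auto)
  also have "\<dots> \<le> 0" using le1 mp by (simp add: prob_space)
  finally show ?thesis
    using ld lp shannon_entropy_eq_expectation[OF V S] by (simp add: p_def prob_space)
qed

text \<open>
  The coding bound: if \<open>Z\<close> determines \<open>S\<close>, then the fibre of \<open>Z\<close> through a point lies in that of
  \<open>S\<close>, so the entropy of \<open>S\<close> is at most that of \<open>Z\<close>; and by Gibbs' inequality the latter is at most
  the expected code length \<open>- ln q\<close> of any sub-probability vector \<open>q\<close>.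
\<close>
lemma shannon_entropy_le_code_length:
  fixes q :: "'c \<Rightarrow> real"
  assumes V: "finite V" and S: "S \<in> M \<rightarrow>\<^sub>M count_space V"
    and W: "finite W" and Z: "Z \<in> M \<rightarrow>\<^sub>M count_space W"
    and det: "AE x in M. x \<in> G" "\<And>x y. x \<in> G \<Longrightarrow> y \<in> G \<Longrightarrow> Z x = Z y \<Longrightarrow> S x = S y"
    and q: "\<And>w. w \<in> W \<Longrightarrow> 0 < q w" "(\<Sum>w\<in>W. q w) \<le> 1"
  shows "shannon_entropy M S V \<le> expectation (\<lambda>x. - ln (q (Z x)))"
proof -
  define r where "r w = prob (Z -` {w} \<inter> space M)" for w
  define p where "p v = prob (S -` {v} \<inter> space M)" for v
  have sr: "(\<Sum>w\<in>W. r w) = 1"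
    using sum_prob_finite_valued[OF W Z] by (simp add: r_def)
  note lp = expectation_finite_valued[OF V S, of "\<lambda>v. ln (p v)"]
  note lr = expectation_finite_valued[OF W Z, of "\<lambda>w. ln (r w)"]
  note lq = expectation_finite_valued[OF W Z, of "\<lambda>w. ln (q w)"]
  have "expectation (\<lambda>x. ln (r (Z x))) \<le> expectation (\<lambda>x. ln (p (S x)))"
  proof (rule integral_mono_AE[OF lr(1) lp(1)])
    show "AE x in M. ln (r (Z x)) \<le> ln (p (S x))"
      using det(1) AE_finite_valued_positive_prob[OF W Z] AE_space
    proof eventually_elim
      case (elim x)
      then have "x \<in> G" by simp
      have "S x \<in> V" using measurable_space[OF S] elim by simp
      then have "S -` {S x} \<inter> space M \<in> events" using measurable_sets[OF S, of "{S x}"] by simp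
      moreover have "AE y in M. y \<in> Z -` {Z x} \<inter> space M \<longrightarrow> y \<in> S -` {S x} \<inter> space M"
        using det(1)
      proof (rule AE_mp, intro AE_I2 impI)
        fix y assume y: "y \<in> space M" "y \<in> G" "y \<in> Z -` {Z x} \<inter> space M"
        then have "S y = S x" using \<open>x \<in> G\<close> by (intro det(2)) simp_all
        with y show "y \<in> S -` {S x} \<inter> space M" by simp
      qed
      ultimately have "r (Z x) \<le> p (S x)"
        unfolding r_def p_def by (intro finite_measure_mono_AE)
      then show ?case using elim by (simp add: r_def)
    qed
  qed
  moreover have "expectation (\<lambda>x. ln (q (Z x))) \<le> expectation (\<lambda>x. ln (r (Z x)))"
  proof -
    have "r w * ln (q w) - r w * ln (r w) \<le> q w - r w" if "w \<in> W" for w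
    proof (cases "r w = 0")
      case False
      then have r0: "0 < r w" by (simp add: r_def zero_less_measure_iff)
      have "r w * ln (q w / r w) \<le> r w * (q w / r w - 1)"
        using r0 q(1)[OF that] by (intro mult_left_mono ln_le_minus_one) auto
      then show ?thesis using r0 q(1)[OF that] by (simp add: ln_div algebra_simps)
    qed (use q(1)[OF that] in simp)
    then have "(\<Sum>w\<in>W. r w * ln (q w) - r w * ln (r w)) \<le> (\<Sum>w\<in>W. q w - r w)"
      by (rule sum_mono)
    also have "\<dots> \<le> 0" using sr q(2) by (simp add: sum_subtractf)
    finally show ?thesis
      using lr(2) lq(2) by (simp add: sum_subtractf r_def)
  qed
  ultimately show ?thesis
    using shannon_entropy_eq_expectation[OF V S] by (simp add: p_def)
qed

end

section \<open>Words of letters\<close>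

text \<open>
  A weakly increasing word of length \<open>n\<close> is determined by how many of its letters are at most \<open>t\<close>,
  for every letter \<open>t\<close>.  Hence there are only polynomially many, so recording one costs \<open>O(ln n)\<close>
  of entropy.
\<close>
lemma card_monotone_words:
  fixes T :: "'a::linorder set"
  assumes T: "finite T"
  shows "finite {w \<in> {1..n} \<rightarrow>\<^sub>E T. mono_on {1..n} w}"
    and "card {w \<in> {1..n} \<rightarrow>\<^sub>E T. mono_on {1..n} w} \<le> (n + 1) ^ card T"
proof -
  define W where "W = {w \<in> {1..n} \<rightarrow>\<^sub>E T. mono_on {1..n} w}"
  define N where "N w = (\<lambda>t\<in>T. card {i\<in>{1..n}. w i \<le> t})" for w :: "nat \<Rightarrow> 'a"
  have initial: "w i \<le> t \<longleftrightarrow> i \<le> card {j\<in>{1..n}. w j \<le> t}"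
    if w: "mono_on {1..n} w" and i: "i \<in> {1..n}" for w :: "nat \<Rightarrow> 'a" and i t
  proof
    assume "w i \<le> t"
    then have "{1..i} \<subseteq> {j\<in>{1..n}. w j \<le> t}"
      using i by (auto intro: order_trans[OF mono_onD[OF w _ i]])
    from card_mono[OF _ this] show "i \<le> card {j\<in>{1..n}. w j \<le> t}" by simp
  next
    assume le: "i \<le> card {j\<in>{1..n}. w j \<le> t}"
    show "w i \<le> t"
    proof (rule ccontr)
      assume "\<not> w i \<le> t"
      then have "{j\<in>{1..n}. w j \<le> t} \<subseteq> {1..<i}"
        using order_trans[OF mono_onD[OF w i]] by (auto simp: not_le[symmetric])
      from card_mono[OF _ this] have "card {j\<in>{1..n}. w j \<le> t} \<le> i - 1" by simp
      with le i show False by auto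
    qed
  qed
  have inj: "inj_on N W"
  proof (rule inj_onI)
    fix w w' assume w: "w \<in> W" "w' \<in> W" and eq: "N w = N w'"
    have "w i = w' i" if i: "i \<in> {1..n}" for i
    proof -
      have c: "card {j\<in>{1..n}. w j \<le> t} = card {j\<in>{1..n}. w' j \<le> t}" if "t \<in> T" for t
        using fun_cong[OF eq, of t] that by (simp add: N_def)
      have "w i \<in> T" "w' i \<in> T" using w i by (auto simp: W_def)
      moreover have "mono_on {1..n} w" "mono_on {1..n} w'" using w by (auto simp: W_def)
      ultimately have "w i \<le> t \<longleftrightarrow> w' i \<le> t" if "t \<in> T" for t
        using initial[OF _ i, of w t] initial[OF _ i, of w' t] c[OF that] by simp
      from this[of "w i"] this[of "w' i"] \<open>w i \<in> T\<close> \<open>w' i \<in> T\<close> show "w i = w' i" by auto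
    qed
    then show "w = w'"
      using w by (intro PiE_ext[of w "{1..n}" "\<lambda>_. T" w']) (auto simp: W_def)
  qed
  have sub: "N ` W \<subseteq> T \<rightarrow>\<^sub>E {0..n}"
  proof -
    have "card {i\<in>{1..n}. w i \<le> t} \<le> n" for w :: "nat \<Rightarrow> 'a" and t
      using card_mono[of "{1..n}" "{i\<in>{1..n}. w i \<le> t}"] by (simp add: subset_iff)
    then show ?thesis by (auto simp: N_def)
  qed
  have fin: "finite (T \<rightarrow>\<^sub>E {0..n})" using T by (intro finite_PiE) auto
  have "finite W"
    unfolding W_def using T by (intro finite_subset[OF _ finite_PiE[of "{1..n}" "\<lambda>_. T"]]) auto
  have "card W = card (N ` W)" using inj by (simp add: card_image)
  also have "\<dots> \<le> card (T \<rightarrow>\<^sub>E {0..n})" by (rule card_mono[OF fin sub])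
  also have "\<dots> = (n + 1) ^ card T" using T by (simp add: card_PiE)
  finally have "card W \<le> (n + 1) ^ card T" .
  with \<open>finite W\<close> show "finite {w \<in> {1..n} \<rightarrow>\<^sub>E T. mono_on {1..n} w}"
    "card {w \<in> {1..n} \<rightarrow>\<^sub>E T. mono_on {1..n} w} \<le> (n + 1) ^ card T"
    by (simp_all add: W_def)
qed

definition word_by_rank :: "nat \<Rightarrow> (nat \<Rightarrow> real) \<Rightarrow> (nat \<Rightarrow> 'a) \<Rightarrow> nat \<Rightarrow> 'a" where
  "word_by_rank n z a = (\<lambda>j\<in>{1..n}. a (inv_into {1..n} (rank_of n z) j))"

lemma rank_of_cong:
  assumes "\<And>k. k \<in> {1..n} \<Longrightarrow> z k = z' k" and "i \<in> {1..n}"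
  shows "rank_of n z i = rank_of n z' i"
  unfolding rank_of_def using assms by (intro arg_cong[where f=card] Collect_cong) auto

lemma rank_of_in: "i \<in> {1..n} \<Longrightarrow> rank_of n z i \<in> {1..n}"
  using bij_betwE[OF bij_rank_of] by blast

lemma word_by_rank_rank_of:
  assumes "i \<in> {1..n}"
  shows "word_by_rank n z a (rank_of n z i) = a i"
  using assms rank_of_in[OF assms] bij_betw_imp_inj_on[OF bij_rank_of]
  by (simp add: word_by_rank_def)

lemma rank_of_preimage:
  assumes "j \<in> {1..n}"
  obtains i where "i \<in> {1..n}" "rank_of n z i = j"
  using assms bij_betw_imp_surj_on[OF bij_rank_of, of n z] by (metis imageE)

lemma word_by_rank_in_PiE:
  "(\<And>i. i \<in> {1..n} \<Longrightarrow> a i \<in> T) \<Longrightarrow> word_by_rank n z a \<in> {1..n} \<rightarrow>\<^sub>E T"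
  using bij_betwE[OF bij_betw_inv_into[OF bij_rank_of]] by (auto simp: word_by_rank_def)

lemma rank_of_le_iff:
  assumes "i \<in> {1..n}" "k \<in> {1..n}"
  shows "rank_of n z k \<le> rank_of n z i \<longleftrightarrow> z k < z i \<or> (z k = z i \<and> k \<le> i)"
proof -
  define R where "R i = {k \<in> {1..n}. z k < z i \<or> (z k = z i \<and> k \<le> i)}" for i
  have r: "rank_of n z i = card (R i)" for i by (simp add: rank_of_def R_def)
  have fin: "finite (R i)" for i by (simp add: R_def)
  show ?thesis
  proof (cases "z k < z i \<or> (z k = z i \<and> k \<le> i)")
    case True
    then have "R k \<subseteq> R i" by (auto simp: R_def)
    then show ?thesis using True card_mono[OF fin] by (simp add: r)
  next
    case False
    then have "R i \<subseteq> R k" "k \<in> R k" "k \<notin> R i" using assms by (auto simp: R_def)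
    then have "card (R i) < card (R k)" by (intro psubset_card_mono fin) auto
    then show ?thesis using False by (simp add: r)
  qed
qed

lemma mono_on_word_by_rank:
  assumes "\<And>i k. i \<in> {1..n} \<Longrightarrow> k \<in> {1..n} \<Longrightarrow> z k \<le> z i \<Longrightarrow> a k \<le> a i"
  shows "mono_on {1..n} (word_by_rank n z a)"
proof (rule mono_onI)
  fix j j' assume j: "j \<in> {1..n}" "j' \<in> {1..n}" "j \<le> j'"
  obtain i where i: "i \<in> {1..n}" "rank_of n z i = j" using rank_of_preimage[OF j(1)] .
  obtain i' where i': "i' \<in> {1..n}" "rank_of n z i' = j'" using rank_of_preimage[OF j(2)] .
  have "z i \<le> z i'" using rank_of_le_iff[OF i'(1) i(1), of z] i i' j by auto
  then show "word_by_rank n z a j \<le> word_by_rank n z a j'"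
    using assms[OF i'(1) i(1)] i i' word_by_rank_rank_of by metis
qed

lemma prod_word_by_rank:
  fixes h :: "'a \<Rightarrow> 'b \<Rightarrow> real"
  shows "(\<Prod>j\<in>{1..n}. h (word_by_rank n z a j) (word_by_rank n z b j)) = (\<Prod>i\<in>{1..n}. h (a i) (b i))"
  by (subst prod.reindex_bij_betw[OF bij_rank_of[of n z], symmetric])
     (simp add: word_by_rank_rank_of)

lemma measurable_word_by_rank:
  fixes z :: "'m \<Rightarrow> nat \<Rightarrow> real" and a :: "'m \<Rightarrow> nat \<Rightarrow> 'a"
  assumes z: "\<And>i. i \<in> {1..n} \<Longrightarrow> (\<lambda>x. z x i) \<in> borel_measurable M"
    and T: "finite T" and a: "\<And>i. i \<in> {1..n} \<Longrightarrow> (\<lambda>x. a x i) \<in> M \<rightarrow>\<^sub>M count_space T"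
  shows "(\<lambda>x. word_by_rank n (z x) (a x)) \<in> M \<rightarrow>\<^sub>M count_space ({1..n} \<rightarrow>\<^sub>E T)"
proof -
  have fin: "finite ({1..n} \<rightarrow>\<^sub>E T)" using T by (intro finite_PiE) auto
  have aT: "a x i \<in> T" if "x \<in> space M" "i \<in> {1..n}" for x i
    using measurable_space[OF a[OF that(2)] that(1)] by simp
  show ?thesis
    unfolding measurable_count_space_eq2[OF fin]
  proof (intro conjI ballI funcsetI)
    fix x assume "x \<in> space M"
    then show "word_by_rank n (z x) (a x) \<in> {1..n} \<rightarrow>\<^sub>E T"
      by (intro word_by_rank_in_PiE aT)
  next
    fix w assume w: "w \<in> {1..n} \<rightarrow>\<^sub>E T"
    have "(\<lambda>x. word_by_rank n (z x) (a x)) -` {w} \<inter> space M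
        = {x \<in> space M. \<forall>i\<in>{1..n}. \<forall>j\<in>{1..n}. rank_of n (z x) i = j \<longrightarrow> a x i = w j}"
    proof (intro set_eqI iffI)
      fix x assume x: "x \<in> {x \<in> space M. \<forall>i\<in>{1..n}. \<forall>j\<in>{1..n}. rank_of n (z x) i = j \<longrightarrow> a x i = w j}"
      have "word_by_rank n (z x) (a x) j = w j" if j: "j \<in> {1..n}" for j
      proof -
        obtain i where "i \<in> {1..n}" "rank_of n (z x) i = j" using rank_of_preimage[OF j] .
        then show ?thesis using x j word_by_rank_rank_of[of i n "z x" "a x"] by auto
      qed
      then have "word_by_rank n (z x) (a x) = w"
        using x w aT by (intro PiE_ext[OF word_by_rank_in_PiE w]) auto
      then show "x \<in> (\<lambda>x. word_by_rank n (z x) (a x)) -` {w} \<inter> space M" using x by simp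
    qed (auto simp: word_by_rank_rank_of)
    also have "\<dots> \<in> sets M"
    proof (intro sets.sets_Collect_finite_All)
      fix i j assume i: "i \<in> {1..n}" and j: "j \<in> {1..n}"
      note [measurable] = measurable_rank_of[OF z i]
      have [measurable]: "(\<lambda>x. a x i) \<in> M \<rightarrow>\<^sub>M count_space UNIV"
        using measurable_compose[OF a[OF i], of "\<lambda>t. t" "count_space UNIV"] by simp
      show "{x \<in> space M. rank_of n (z x) i = j \<longrightarrow> a x i = w j} \<in> sets M"
        by measurable
    qed auto
    finally show "(\<lambda>x. word_by_rank n (z x) (a x)) -` {w} \<inter> space M \<in> sets M" .
  qed
qed

section \<open>Permutations read off a sample on a graph\<close>

text \<open>
  To compare two points horizontally, compare their letters first and, for equal letters, their
  vertical ranks (in reverse for the letters in \<open>dec\<close>).  Indexing the points by their vertical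
  ranks turns this into a count that depends on nothing but the word \<open>b\<close> and the vertical rank.
\<close>
lemma rank_of_eq_of_word:
  fixes x y :: "nat \<Rightarrow> real" and a :: "nat \<Rightarrow> 'a::linorder"
  assumes less: "\<And>i k. i \<in> {1..n} \<Longrightarrow> k \<in> {1..n} \<Longrightarrow> a k < a i \<Longrightarrow> x k < x i"
    and inc: "\<And>i k. i \<in> {1..n} \<Longrightarrow> k \<in> {1..n} \<Longrightarrow> a k = a i \<Longrightarrow> a i \<notin> dec \<Longrightarrow> y k < y i \<longleftrightarrow> x k < x i"
    and dec: "\<And>i k. i \<in> {1..n} \<Longrightarrow> k \<in> {1..n} \<Longrightarrow> a k = a i \<Longrightarrow> a i \<in> dec \<Longrightarrow> y k < y i \<longleftrightarrow> x i < x k"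
    and distinct: "inj_on x {1..n}"
    and i: "i \<in> {1..n}"
  defines "b \<equiv> word_by_rank n y a"
  shows "rank_of n x i = card {j \<in> {1..n}. b j < b (rank_of n y i) \<or>
    (b j = b (rank_of n y i) \<and> (if b j \<in> dec then rank_of n y i \<le> j else j \<le> rank_of n y i))}"
    (is "_ = card ?R")
proof -
  have b: "b (rank_of n y k) = a k" if "k \<in> {1..n}" for k
    unfolding b_def by (rule word_by_rank_rank_of[OF that])
  have eq: "x k \<le> x i \<longleftrightarrow> a k < a i \<or>
      (a k = a i \<and> (if a k \<in> dec then rank_of n y i \<le> rank_of n y k else rank_of n y k \<le> rank_of n y i))"
    if k: "k \<in> {1..n}" for k
  proof (cases "k = i")
    case False
    then have ne: "x k \<noteq> x i" using distinct k i by (auto dest: inj_onD)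
    consider "a k < a i" | "a i < a k" | "a k = a i" by fastforce
    then show ?thesis
    proof cases
      case 3
      have "y k \<noteq> y i"
        using inc[OF i k 3] inc[OF k i] dec[OF i k 3] dec[OF k i] 3 ne
        by (metis linorder_less_linear order_less_irrefl)
      then show ?thesis
        using inc[OF i k 3] dec[OF i k 3] 3 ne rank_of_le_iff[OF i k, of y] rank_of_le_iff[OF k i, of y]
        by auto
    qed (use less[OF i k] less[OF k i] in auto)
  qed simp
  have "rank_of n x i = card {k \<in> {1..n}. x k \<le> x i}"
    unfolding rank_of_def using distinct i
    by (intro arg_cong[where f=card] Collect_cong) (auto simp: le_less dest: inj_onD)
  also have "\<dots> = card (rank_of n y ` {k \<in> {1..n}. x k \<le> x i})"
    by (intro card_image[symmetric] inj_on_subset[OF bij_betw_imp_inj_on[OF bij_rank_of]]) auto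
  also have "rank_of n y ` {k \<in> {1..n}. x k \<le> x i} = ?R"
  proof (intro set_eqI iffI)
    fix j assume "j \<in> rank_of n y ` {k \<in> {1..n}. x k \<le> x i}"
    then obtain k where k: "k \<in> {1..n}" "x k \<le> x i" "j = rank_of n y k" by blast
    show "j \<in> ?R"
      using rank_of_in[OF k(1)] k(2) unfolding k(3) eq[OF k(1)] by (simp add: b[OF k(1)] b[OF i])
  next
    fix j assume j: "j \<in> ?R"
    then obtain k where k: "k \<in> {1..n}" "rank_of n y k = j" using rank_of_preimage[of j n y] by blast
    have "x k \<le> x i" using j unfolding eq[OF k(1)] k(2)[symmetric] by (simp add: b[OF k(1)] b[OF i])
    then show "j \<in> rank_of n y ` {k \<in> {1..n}. x k \<le> x i}" using k by blast
  qed
  finally show ?thesis .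
qed

text \<open>
  A sampled permutation is the map from horizontal to vertical ranks, so two samples with the same
  correspondence between these ranks have the same permutation.
\<close>
lemma sampled_perm_eqI_ranks:
  assumes "\<And>i i'. i \<in> {1..n} \<Longrightarrow> i' \<in> {1..n} \<Longrightarrow>
      rank_of n (\<lambda>i. snd (p i)) i = rank_of n (\<lambda>i. snd (p' i)) i' \<Longrightarrow>
      rank_of n (\<lambda>i. fst (p i)) i = rank_of n (\<lambda>i. fst (p' i)) i'"
  shows "sampled_perm n p = sampled_perm n p'"
  unfolding sampled_perm_eq_iff[OF sampled_perm_permutes]
proof
  fix i assume i: "i \<in> {1..n}"
  obtain i' where i': "i' \<in> {1..n}" "rank_of n (\<lambda>i. snd (p' i)) i' = rank_of n (\<lambda>i. snd (p i)) i"
    using rank_of_preimage[OF rank_of_in[OF i]] .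
  show "sampled_perm n p' (rank_of n (\<lambda>i. fst (p i)) i) = rank_of n (\<lambda>i. snd (p i)) i"
    using assms[OF i i'(1)] i'(2) sampled_perm_rank[OF i'(1), of p'] by simp
qed

lemma rank_of_fst_eq_of_sampled_perm:
  assumes "sampled_perm n p = sampled_perm n p'" and "i \<in> {1..n}"
    and "\<And>i. i \<in> {1..n} \<Longrightarrow> snd (p i) = snd (p' i)"
  shows "rank_of n (\<lambda>i. fst (p i)) i = rank_of n (\<lambda>i. fst (p' i)) i"
proof -
  have "rank_of n (\<lambda>i. snd (p i)) i = rank_of n (\<lambda>i. snd (p' i)) i"
    using assms(2,3) by (intro rank_of_cong)
  then have "sampled_perm n p (rank_of n (\<lambda>i. fst (p i)) i) = sampled_perm n p (rank_of n (\<lambda>i. fst (p' i)) i)"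
    using sampled_perm_rank[OF assms(2), of p] sampled_perm_rank[OF assms(2), of p'] assms(1) by simp
  then show ?thesis
    using permutes_inj[OF sampled_perm_permutes] by (meson injD)
qed

section \<open>Finite products of densities and image measures\<close>

text \<open>
  Both sides integrate \<open>F\<close> against a finite product measure, and the change of variables in one
  coordinate says that the factors agree.  The functions \<open>d\<close>, \<open>w\<close> and \<open>g\<close> may differ from
  coordinate to coordinate because the branches of a map do.
\<close>
lemma nn_integral_PiM_change_of_variables:
  fixes d w :: "'i \<Rightarrow> 'a \<Rightarrow> ennreal"
  assumes M: "prob_space M" and I: "finite I"
    and d [measurable]: "\<And>i. i \<in> I \<Longrightarrow> d i \<in> borel_measurable M"
    and w [measurable]: "\<And>i. i \<in> I \<Longrightarrow> w i \<in> borel_measurable M"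
    and g [measurable]: "\<And>i. i \<in> I \<Longrightarrow> g i \<in> M \<rightarrow>\<^sub>M M"
    and finite: "\<And>i. i \<in> I \<Longrightarrow> (\<integral>\<^sup>+x. d i x \<partial>M) < \<infinity>"
    and eq: "\<And>i. i \<in> I \<Longrightarrow> distr (density M (w i)) M (g i) = density M (d i)"
    and F [measurable]: "F \<in> borel_measurable (PiM I (\<lambda>_. M))"
  shows "(\<integral>\<^sup>+X. (\<Prod>i\<in>I. d i (X i)) * F X \<partial>PiM I (\<lambda>_. M)) =
    (\<integral>\<^sup>+Y. (\<Prod>i\<in>I. w i (Y i)) * F (\<lambda>i\<in>I. g i (Y i)) \<partial>PiM I (\<lambda>_. M))"
proof -
  let ?P = "PiM I (\<lambda>_. M)"
  interpret prob_space M by fact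
  interpret product_sigma_finite "\<lambda>_::'i. M" by unfold_locales
  define N where "N i = (if i \<in> I then density M (d i) else M)" for i
  have "finite_measure (N i)" for i
  proof (cases "i \<in> I")
    case True
    then show ?thesis
      using finite[OF True] by (intro finite_measureI) (simp add: N_def emeasure_density cong: nn_integral_cong)
  qed (simp add: N_def finite_measure_axioms)
  then interpret N: product_sigma_finite N
    by (intro product_sigma_finite.intro finite_measure.axioms(1))
  have sN: "sets (PiM I N) = sets ?P"
    by (intro sets_PiM_cong) (auto simp: N_def)
  have gm [measurable]: "(\<lambda>Y. \<lambda>i\<in>I. g i (Y i)) \<in> ?P \<rightarrow>\<^sub>M ?P"
    by measurable
  have dm [measurable]: "(\<lambda>X. \<Prod>i\<in>I. d i (X i)) \<in> borel_measurable ?P"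
    and wm [measurable]: "(\<lambda>X. \<Prod>i\<in>I. w i (X i)) \<in> borel_measurable ?P"
    by measurable
  have box: "(\<integral>\<^sup>+X. (\<Prod>i\<in>I. u i (X i)) * (indicator (Pi\<^sub>E I A) (\<lambda>i\<in>I. h i (X i)) :: ennreal) \<partial>?P)
      = (\<Prod>i\<in>I. \<integral>\<^sup>+x. u i x * indicator (A i) (h i x) \<partial>M)"
    if Auh: "\<And>i. i \<in> I \<Longrightarrow> A i \<in> sets M" "\<And>i. i \<in> I \<Longrightarrow> u i \<in> borel_measurable M"
      "\<And>i. i \<in> I \<Longrightarrow> h i \<in> M \<rightarrow>\<^sub>M M" for A u and h :: "'i \<Rightarrow> 'a \<Rightarrow> 'a"
  proof -
    have "(\<Prod>i\<in>I. u i (X i)) * (indicator (Pi\<^sub>E I A) (\<lambda>i\<in>I. h i (X i)) :: ennreal)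
        = (\<Prod>i\<in>I. u i (X i) * indicator (A i) (h i (X i)))" for X
    proof (cases "\<forall>i\<in>I. h i (X i) \<in> A i")
      case True
      then show ?thesis by (simp add: indicator_def)
    next
      case False
      then have "(\<Prod>i\<in>I. u i (X i) * indicator (A i) (h i (X i))) = 0"
        using I by (intro prod_zero) (auto simp: indicator_def)
      then show ?thesis using False by (auto simp: indicator_def)
    qed
    moreover have "(\<lambda>x. u i x * indicator (A i) (h i x)) \<in> borel_measurable M" if i: "i \<in> I" for i
    proof -
      note [measurable] = Auh(1)[OF i] Auh(2)[OF i] Auh(3)[OF i]
      show ?thesis by measurable
    qed
    ultimately show ?thesis
      using product_nn_integral_prod[OF I, of "\<lambda>i x. u i x * indicator (A i) (h i x)"] by simp
  qed
  have P1: "density ?P (\<lambda>X. \<Prod>i\<in>I. d i (X i)) = PiM I N"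
  proof (rule N.PiM_eqI[OF I])
    fix A assume "\<And>i. i \<in> I \<Longrightarrow> A i \<in> sets (N i)"
    then have A: "A i \<in> sets M" if "i \<in> I" for i using that by (auto simp: N_def)
    have "emeasure (density ?P (\<lambda>X. \<Prod>i\<in>I. d i (X i))) (Pi\<^sub>E I A)
        = (\<integral>\<^sup>+X. (\<Prod>i\<in>I. d i (X i)) * indicator (Pi\<^sub>E I A) (\<lambda>i\<in>I. X i) \<partial>?P)"
      using A I by (subst emeasure_density) (auto intro!: nn_integral_cong sets_PiM_I_finite
          simp: space_PiM)
    also have "\<dots> = (\<Prod>i\<in>I. \<integral>\<^sup>+x. d i x * indicator (A i) x \<partial>M)"
      using A d by (subst box) auto
    also have "\<dots> = (\<Prod>i\<in>I. emeasure (N i) (A i))"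
      using A d by (intro prod.cong) (auto simp: N_def emeasure_density)
    finally show "emeasure (density ?P (\<lambda>X. \<Prod>i\<in>I. d i (X i))) (Pi\<^sub>E I A) = (\<Prod>i\<in>I. emeasure (N i) (A i))" .
  qed (simp add: sN)
  have P2: "distr (density ?P (\<lambda>Y. \<Prod>i\<in>I. w i (Y i))) ?P (\<lambda>Y. \<lambda>i\<in>I. g i (Y i)) = PiM I N"
  proof (rule N.PiM_eqI[OF I])
    fix A assume "\<And>i. i \<in> I \<Longrightarrow> A i \<in> sets (N i)"
    then have A: "A i \<in> sets M" if "i \<in> I" for i using that by (auto simp: N_def)
    have PA: "Pi\<^sub>E I A \<in> sets ?P" using A I by (intro sets_PiM_I_finite)
    have "emeasure (distr (density ?P (\<lambda>Y. \<Prod>i\<in>I. w i (Y i))) ?P (\<lambda>Y. \<lambda>i\<in>I. g i (Y i))) (Pi\<^sub>E I A)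
        = (\<integral>\<^sup>+X. indicator (Pi\<^sub>E I A) X \<partial>distr (density ?P (\<lambda>Y. \<Prod>i\<in>I. w i (Y i))) ?P (\<lambda>Y. \<lambda>i\<in>I. g i (Y i)))"
      using PA by simp
    also have "\<dots> = (\<integral>\<^sup>+Y. indicator (Pi\<^sub>E I A) (\<lambda>i\<in>I. g i (Y i)) \<partial>density ?P (\<lambda>Y. \<Prod>i\<in>I. w i (Y i)))"
      using PA by (intro nn_integral_distr) simp_all
    also have "\<dots> = (\<integral>\<^sup>+Y. (\<Prod>i\<in>I. w i (Y i)) * indicator (Pi\<^sub>E I A) (\<lambda>i\<in>I. g i (Y i)) \<partial>?P)"
      using wm measurable_compose[OF gm borel_measurable_indicator[OF PA]] by (intro nn_integral_density)
    also have "\<dots> = (\<Prod>i\<in>I. \<integral>\<^sup>+y. w i y * indicator (A i) (g i y) \<partial>M)"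
      using A w g by (subst box) auto
    also have "\<dots> = (\<Prod>i\<in>I. emeasure (N i) (A i))"
    proof (rule prod.cong[OF refl])
      fix i assume i: "i \<in> I"
      note [measurable] = A[OF i] g[OF i] w[OF i]
      have "(\<integral>\<^sup>+y. w i y * indicator (A i) (g i y) \<partial>M) = (\<integral>\<^sup>+y. indicator (A i) (g i y) \<partial>density M (w i))"
        by (subst nn_integral_density) auto
      also have "\<dots> = (\<integral>\<^sup>+x. indicator (A i) x \<partial>distr (density M (w i)) M (g i))"
        by (subst nn_integral_distr) auto
      also have "\<dots> = emeasure (N i) (A i)"
        unfolding eq[OF i] using i A[OF i] by (simp add: N_def)
      finally show "(\<integral>\<^sup>+y. w i y * indicator (A i) (g i y) \<partial>M) = emeasure (N i) (A i)" .
    qed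
    finally show "emeasure (distr (density ?P (\<lambda>Y. \<Prod>i\<in>I. w i (Y i))) ?P (\<lambda>Y. \<lambda>i\<in>I. g i (Y i))) (Pi\<^sub>E I A)
        = (\<Prod>i\<in>I. emeasure (N i) (A i))" .
  qed (simp add: sN)
  have "(\<integral>\<^sup>+X. (\<Prod>i\<in>I. d i (X i)) * F X \<partial>?P) = (\<integral>\<^sup>+X. F X \<partial>density ?P (\<lambda>X. \<Prod>i\<in>I. d i (X i)))"
    by (subst nn_integral_density) auto
  also have "\<dots> = (\<integral>\<^sup>+X. F X \<partial>distr (density ?P (\<lambda>Y. \<Prod>i\<in>I. w i (Y i))) ?P (\<lambda>Y. \<lambda>i\<in>I. g i (Y i)))"
    by (simp add: P1 P2)
  also have "\<dots> = (\<integral>\<^sup>+Y. F (\<lambda>i\<in>I. g i (Y i)) \<partial>density ?P (\<lambda>Y. \<Prod>i\<in>I. w i (Y i)))"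
    by (intro nn_integral_distr) simp_all
  also have "\<dots> = (\<integral>\<^sup>+Y. (\<Prod>i\<in>I. w i (Y i)) * F (\<lambda>i\<in>I. g i (Y i)) \<partial>?P)"
    using wm measurable_compose[OF gm F] by (intro nn_integral_density)
  finally show ?thesis .
qed

lemma AE_PiM_inj_on:
  fixes M :: "'a measure"
  assumes M: "prob_space M" and I: "finite I"
    and diag: "AE z in M \<Otimes>\<^sub>M M. fst z \<noteq> snd z"
  shows "AE X in PiM I (\<lambda>_. M). inj_on X I"
proof -
  interpret M: prob_space M by fact
  interpret product_prob_space "\<lambda>_. M" I by unfold_locales
  have "AE X in PiM I (\<lambda>_. M). X i \<noteq> X j" if ij: "i \<in> I" "j \<in> I" "i \<noteq> j" for i j
  proof -
    have eq: "M \<Otimes>\<^sub>M M = distr (PiM I (\<lambda>_. M)) (M \<Otimes>\<^sub>M M) (\<lambda>X. (X i, X j))"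
    proof (rule pair_measure_eqI)
      fix A B assume A: "A \<in> sets M" and B: "B \<in> sets M"
      have "emeasure (distr (PiM I (\<lambda>_. M)) (M \<Otimes>\<^sub>M M) (\<lambda>X. (X i, X j))) (A \<times> B)
          = emeasure (PiM I (\<lambda>_. M)) {X \<in> space (PiM I (\<lambda>_. M)). \<forall>k\<in>{i, j}. X k \<in> (if k = i then A else B)}"
        using A B ij by (subst emeasure_distr) (auto intro!: arg_cong[where f="emeasure _"])
      also have "\<dots> = (\<Prod>k\<in>{i, j}. emeasure M (if k = i then A else B))"
        using A B ij by (intro emeasure_PiM_Collect) auto
      finally show "emeasure M A * emeasure M B
          = emeasure (distr (PiM I (\<lambda>_. M)) (M \<Otimes>\<^sub>M M) (\<lambda>X. (X i, X j))) (A \<times> B)"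
        using ij by simp
    qed (simp_all add: M.sigma_finite_measure_axioms)
    have m: "(\<lambda>X. (X i, X j)) \<in> PiM I (\<lambda>_. M) \<rightarrow>\<^sub>M M \<Otimes>\<^sub>M M" using ij by measurable
    have ae: "AE z in distr (PiM I (\<lambda>_. M)) (M \<Otimes>\<^sub>M M) (\<lambda>X. (X i, X j)). fst z \<noteq> snd z"
      using diag by (subst eq[symmetric])
    from AE_distrD[OF m ae] show ?thesis by simp
  qed
  then have "AE X in PiM I (\<lambda>_. M). \<forall>i\<in>I. \<forall>j\<in>I. i \<noteq> j \<longrightarrow> X i \<noteq> X j"
    using I by (intro AE_finite_allI) (auto intro!: AE_impI)
  then show ?thesis
    by eventually_elim (auto simp: inj_on_def)
qed

section \<open>Branches of a piecewise smooth measure-preserving map\<close>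

lemma emeasure_unit_lebesgue:
  "A \<in> sets unit_lebesgue \<Longrightarrow> emeasure unit_lebesgue A = emeasure lborel A"
  unfolding unit_lebesgue_def by (subst emeasure_restrict_space) (auto simp: sets_restrict_space)

lemma borel_subset_in_sets_unit_lebesgue:
  "A \<in> sets borel \<Longrightarrow> A \<subseteq> {0..1} \<Longrightarrow> A \<in> sets unit_lebesgue"
  unfolding unit_lebesgue_def by (auto simp: sets_restrict_space)

lemma sets_unit_lebesgueD: "A \<in> sets unit_lebesgue \<Longrightarrow> A \<in> sets borel \<and> A \<subseteq> {0..1}"
  unfolding unit_lebesgue_def by (auto simp: sets_restrict_space)

lemma measurable_unit_lebesgue_if_borel:
  "h \<in> borel \<rightarrow>\<^sub>M N \<Longrightarrow> h \<in> unit_lebesgue \<rightarrow>\<^sub>M N"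
  unfolding unit_lebesgue_def by (simp add: measurable_restrict_space1)

lemma measurable_into_unit_lebesgue:
  assumes "h \<in> borel_measurable M" and "\<And>x. x \<in> space M \<Longrightarrow> h x \<in> {0..1}"
  shows "h \<in> M \<rightarrow>\<^sub>M unit_lebesgue"
proof -
  have "M \<rightarrow>\<^sub>M unit_lebesgue = M \<rightarrow>\<^sub>M restrict_space borel {0..1}"
    by (rule measurable_cong_sets) (simp_all add: sets_unit_lebesgue)
  then show ?thesis using assms by (auto intro!: measurable_restrict_space2)
qed

lemma borel_measurable_ident_unit_lebesgue: "(\<lambda>x. x) \<in> borel_measurable unit_lebesgue"
  by (rule measurable_unit_lebesgue_if_borel) simp

lemma finite_null_sets_unit_lebesgue:
  assumes "finite N" "N \<subseteq> {0..1}"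
  shows "N \<in> null_sets unit_lebesgue"
proof -
  have N: "N \<in> sets unit_lebesgue"
    using assms by (intro borel_subset_in_sets_unit_lebesgue borel_closed finite_imp_closed)
  then show ?thesis
    using emeasure_unit_lebesgue[OF N] finite_imp_null_set_lborel[OF assms(1)]
    by (simp add: null_sets_def)
qed

lemma AE_unit_lebesgue_pair_distinct:
  "AE z in unit_lebesgue \<Otimes>\<^sub>M unit_lebesgue. fst z \<noteq> snd z"
proof -
  interpret prob_space unit_lebesgue by (rule prob_space_unit_lebesgue)
  interpret P: pair_prob_space unit_lebesgue unit_lebesgue ..
  note [measurable] = measurable_compose[OF measurable_fst borel_measurable_ident_unit_lebesgue]
    measurable_compose[OF measurable_snd borel_measurable_ident_unit_lebesgue]
  have "AE y in unit_lebesgue. x \<noteq> y" for x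
  proof -
    have "{x} \<inter> {0..1} \<in> null_sets unit_lebesgue"
      by (rule finite_null_sets_unit_lebesgue) auto
    then have "AE y in unit_lebesgue. y \<notin> {x} \<inter> {0..1}" by (rule AE_not_in)
    then show ?thesis using AE_space by eventually_elim auto
  qed
  then show ?thesis
    by (intro P.AE_pair_measure) (auto intro!: measurable_sets)
qed

text \<open>
  The branch \<open>U t\<close> is named by one of its points \<open>t\<close>, so that the order of the names is the
  left-to-right order of the branches.
\<close>
locale branched_map =
  fixes f :: "real \<Rightarrow> real" and T :: "real set" and U :: "real \<Rightarrow> real set"
  assumes preserving: "lebesgue_preserving f"
    and finite_T: "finite T"
    and U_open: "t \<in> T \<Longrightarrow> open (U t)"
    and U_interval: "t \<in> T \<Longrightarrow> is_interval (U t)"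
    and U_subset: "t \<in> T \<Longrightarrow> U t \<subseteq> {0..1}"
    and name_in_U: "t \<in> T \<Longrightarrow> t \<in> U t"
    and U_less: "t \<in> T \<Longrightarrow> t' \<in> T \<Longrightarrow> t < t' \<Longrightarrow> x \<in> U t \<Longrightarrow> x' \<in> U t' \<Longrightarrow> x < x'"
    and U_C1: "t \<in> T \<Longrightarrow> f C1_differentiable_on (U t)"
    and finite_complement: "finite ({0..1} - (\<Union>t\<in>T. U t))"
begin

abbreviation "branches \<equiv> \<Union>t\<in>T. U t"

lemma f_measurable: "f \<in> unit_lebesgue \<rightarrow>\<^sub>M unit_lebesgue"
  using preserving by (simp add: lebesgue_preserving_def)

lemma f_in_unit: "x \<in> {0..1} \<Longrightarrow> f x \<in> {0..1}"
  using measurable_space[OF f_measurable, of x] by simp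

lemma f_borel: "f \<in> borel_measurable unit_lebesgue"
  by (rule measurable_compose[OF f_measurable borel_measurable_ident_unit_lebesgue])

lemma emeasure_vimage_f:
  assumes "B \<in> sets unit_lebesgue"
  shows "emeasure unit_lebesgue {x \<in> {0..1}. f x \<in> B} = emeasure unit_lebesgue B"
proof -
  have "{x \<in> {0..1}. f x \<in> B} = f -` B \<inter> space unit_lebesgue" by auto
  then have "emeasure unit_lebesgue {x \<in> {0..1}. f x \<in> B} = emeasure (distr unit_lebesgue unit_lebesgue f) B"
    using emeasure_distr[OF f_measurable assms] by simp
  then show ?thesis using preserving by (simp add: lebesgue_preserving_def)
qed

lemma AE_in_branches: "AE x in unit_lebesgue. x \<in> branches"
proof -
  have "AE x in unit_lebesgue. x \<notin> {0..1} - branches"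
    by (intro AE_not_in finite_null_sets_unit_lebesgue finite_complement) auto
  then show ?thesis
    using AE_space by eventually_elim auto
qed

lemma has_deriv:
  assumes "t \<in> T" "x \<in> U t"
  shows "(f has_real_derivative deriv f x) (at x)"
  using U_C1[OF assms(1)] assms(2) unfolding C1_differentiable_on_def
  by (metis DERIV_imp_deriv has_real_derivative_iff_has_vector_derivative)

lemma continuous_deriv:
  assumes "t \<in> T"
  shows "continuous_on (U t) (deriv f)"
proof -
  obtain D where D: "\<And>x. x \<in> U t \<Longrightarrow> (f has_vector_derivative D x) (at x)" "continuous_on (U t) D"
    using U_C1[OF assms] unfolding C1_differentiable_on_def by blast
  have "D x = deriv f x" if "x \<in> U t" for x
    using D(1)[OF that] by (metis DERIV_imp_deriv has_real_derivative_iff_has_vector_derivative)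
  then show ?thesis using D(2) by (simp cong: continuous_on_cong)
qed

text \<open>
  If \<open>|f'(x)| < 1\<close>, then \<open>f\<close> maps a small interval around \<open>x\<close> into a strictly shorter one, whose
  preimage would be too large.
\<close>
lemma abs_deriv_ge_1:
  assumes t: "t \<in> T" and x: "x \<in> U t"
  shows "1 \<le> \<bar>deriv f x\<bar>"
proof (rule ccontr)
  assume less: "\<not> 1 \<le> \<bar>deriv f x\<bar>"
  define r where "r = (\<bar>deriv f x\<bar> + 1) / 2"
  have r: "0 < r" "r < 1" "0 < r - \<bar>deriv f x\<bar>" using less by (auto simp: r_def)
  have "(f has_derivative (\<lambda>h. deriv f x * h)) (at x)"
    using has_deriv[OF t x] by (simp add: has_field_derivative_def)
  then obtain d where d: "d > 0"
    "\<And>y. \<bar>y - x\<bar> < d \<Longrightarrow> \<bar>f y - f x - deriv f x * (y - x)\<bar> \<le> (r - \<bar>deriv f x\<bar>) * \<bar>y - x\<bar>"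
    using r(3) unfolding has_derivative_at_alt real_norm_def by meson
  obtain e where e: "e > 0" "cball x e \<subseteq> U t"
    using U_open[OF t] x open_contains_cball by blast
  define s where "s = min e (d / 2)"
  have s: "0 < s" "s < d" "s \<le> e" using d e by (auto simp: s_def)
  have sub: "cball x s \<subseteq> {0..1}" using e s U_subset[OF t] by (meson subset_cball order_trans)
  define B where "B = cball (f x) (r * s) \<inter> {0..1}"
  have B: "B \<in> sets unit_lebesgue" by (intro borel_subset_in_sets_unit_lebesgue) (auto simp: B_def)
  have "f y \<in> B" if y: "y \<in> cball x s" for y
  proof -
    have yx: "\<bar>y - x\<bar> \<le> s" using y by (simp add: dist_real_def abs_minus_commute)
    have "\<bar>f y - f x\<bar> \<le> \<bar>f y - f x - deriv f x * (y - x)\<bar> + \<bar>deriv f x * (y - x)\<bar>" by linarith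
    also have "\<dots> \<le> (r - \<bar>deriv f x\<bar>) * \<bar>y - x\<bar> + \<bar>deriv f x\<bar> * \<bar>y - x\<bar>"
      using d(2)[of y] yx s by (simp add: abs_mult)
    also have "\<dots> = r * \<bar>y - x\<bar>" by (simp add: algebra_simps)
    also have "\<dots> \<le> r * s" using yx r by simp
    finally have "f y \<in> cball (f x) (r * s)" by (simp add: dist_real_def abs_minus_commute)
    then show "f y \<in> B" using f_in_unit[of y] sub y by (auto simp: B_def)
  qed
  then have incl: "cball x s \<subseteq> {y \<in> {0..1}. f y \<in> B}" using sub by auto
  have "{y \<in> {0..1}. f y \<in> B} = f -` B \<inter> space unit_lebesgue" by auto
  then have pre: "{y \<in> {0..1}. f y \<in> B} \<in> sets unit_lebesgue"
    using measurable_sets[OF f_measurable B] by simp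
  have "cball x s \<in> sets unit_lebesgue" using sub by (intro borel_subset_in_sets_unit_lebesgue) auto
  then have "ennreal (2 * s) = emeasure unit_lebesgue (cball x s)"
    using s by (simp add: emeasure_unit_lebesgue cball_eq_atLeastAtMost)
  also have "\<dots> \<le> emeasure unit_lebesgue {y \<in> {0..1}. f y \<in> B}"
    by (intro emeasure_mono incl pre)
  also have "\<dots> = emeasure lborel B"
    by (simp only: emeasure_vimage_f[OF B] emeasure_unit_lebesgue[OF B])
  also have "\<dots> \<le> emeasure lborel (cball (f x) (r * s))"
    by (intro emeasure_mono) (auto simp: B_def)
  also have "\<dots> = ennreal (2 * (r * s))"
    using s r by (simp add: cball_eq_atLeastAtMost)
  finally have "2 * s \<le> 2 * (r * s)" using s r by (simp add: ennreal_le_iff)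
  then show False using s r by simp
qed

lemma mean_value:
  assumes t: "t \<in> T" and x: "x \<in> U t" and y: "y \<in> U t" and less: "x < y"
  obtains z where "z \<in> U t" "x < z" "z < y" "f y - f x = (y - x) * deriv f z"
proof -
  have sub: "{x..y} \<subseteq> U t"
    using U_interval[OF t] x y by (meson is_interval_1 atLeastAtMost_iff subsetI)
  have "\<exists>z>x. z < y \<and> f y - f x = (y - x) * deriv f z"
    using less sub has_deriv[OF t] by (intro MVT2) auto
  then show ?thesis using that sub by (meson atLeastAtMost_iff less_imp_le subsetD)
qed

definition "decreasing = {t \<in> T. deriv f t < 0}"

text \<open>The continuous derivative avoids \<open>(-1, 1)\<close> on the interval \<open>U t\<close>, so it keeps its sign.\<close>
lemma deriv_sign:
  assumes t: "t \<in> T" and x: "x \<in> U t"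
  shows "if t \<in> decreasing then deriv f x \<le> - 1 else 1 \<le> deriv f x"
proof -
  have "connected (deriv f ` U t)"
    using continuous_deriv[OF t] U_interval[OF t]
    by (intro connected_continuous_image) (auto simp: is_interval_connected)
  moreover have "0 \<notin> deriv f ` U t" using abs_deriv_ge_1[OF t] by force
  ultimately have same: "\<not> (deriv f a < 0 \<and> 0 < deriv f b)" if "a \<in> U t" "b \<in> U t" for a b
    using that by (meson connectedD_interval imageI less_imp_le)
  show ?thesis
    using same[of t x] same[of x t] name_in_U[OF t] x t
      abs_deriv_ge_1[OF t x] abs_deriv_ge_1[OF t name_in_U[OF t]]
    by (auto simp: decreasing_def)
qed

lemma expanding:
  assumes t: "t \<in> T" and x: "x \<in> U t" and y: "y \<in> U t" and less: "x < y"
  shows "if t \<in> decreasing then y - x \<le> f x - f y else y - x \<le> f y - f x"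
proof -
  obtain z where z: "z \<in> U t" "f y - f x = (y - x) * deriv f z"
    using mean_value[OF t x y less] .
  show ?thesis
    using deriv_sign[OF t z(1)] less
      mult_left_mono[of 1 "deriv f z" "y - x"] mult_left_mono[of "deriv f z" "- 1" "y - x"]
    by (auto simp: z(2)[symmetric] minus_le_iff split: if_splits)
qed

lemma f_less_iff:
  assumes t: "t \<in> T" and x: "x \<in> U t" and y: "y \<in> U t"
  shows "t \<notin> decreasing \<Longrightarrow> f x < f y \<longleftrightarrow> x < y" and "t \<in> decreasing \<Longrightarrow> f x < f y \<longleftrightarrow> y < x"
  using expanding[OF t x y] expanding[OF t y x] by (cases x y rule: linorder_cases; force)+

lemma inj_on_branch: "t \<in> T \<Longrightarrow> inj_on f (U t)"
  by (rule inj_onI) (metis f_less_iff linorder_less_linear order_less_irrefl)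

lemma continuous_f: "t \<in> T \<Longrightarrow> continuous_on (U t) f"
  by (intro DERIV_continuous_on[of _ _ "deriv f"]) (auto intro: has_field_derivative_at_within has_deriv)

lemma open_image:
  assumes t: "t \<in> T" and "open B" "B \<subseteq> U t"
  shows "open (f ` B)"
  using injective_eq_1d_open_map_UNIV[OF continuous_f[OF t] U_interval[OF t]] inj_on_branch[OF t] assms
  by blast

text \<open>The value \<open>t\<close> outside \<open>f ` U t\<close> makes this a map into \<open>U t\<close>, hence of the unit interval.\<close>
definition inverse_branch :: "real \<Rightarrow> real \<Rightarrow> real" where
  "inverse_branch t y = (if y \<in> f ` U t then inv_into (U t) f y else t)"

lemma inverse_branch_f: "t \<in> T \<Longrightarrow> x \<in> U t \<Longrightarrow> inverse_branch t (f x) = x"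
  by (simp add: inverse_branch_def inj_on_branch)

lemma inverse_branch_in_U: "t \<in> T \<Longrightarrow> inverse_branch t y \<in> U t"
  by (auto simp: inverse_branch_def name_in_U intro: inv_into_into)

lemma f_inverse_branch: "y \<in> f ` U t \<Longrightarrow> f (inverse_branch t y) = y"
  by (simp add: inverse_branch_def f_inv_into_f)

lemma inverse_branch_borel: "t \<in> T \<Longrightarrow> inverse_branch t \<in> borel_measurable borel"
proof (rule borel_measurableI)
  fix S :: "real set" assume t: "t \<in> T" and S: "open S"
  have eq: "inverse_branch t -` S \<inter> space borel
      = f ` (U t \<inter> S) \<union> (if t \<in> S then - (f ` U t) else {})"
  proof (rule set_eqI)
    fix y
    show "y \<in> inverse_branch t -` S \<inter> space borel \<longleftrightarrow>
        y \<in> f ` (U t \<inter> S) \<union> (if t \<in> S then - (f ` U t) else {})"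
    proof (cases "y \<in> f ` U t")
      case True
      then obtain x where "x \<in> U t" "y = f x" by blast
      then show ?thesis
        by (auto simp: inverse_branch_f[OF t] dest: inj_onD[OF inj_on_branch[OF t]])
    qed (auto simp: inverse_branch_def)
  qed
  have "open (f ` (U t \<inter> S))" "open (f ` U t)"
    using open_image[OF t] U_open[OF t] S by auto
  then show "inverse_branch t -` S \<inter> space borel \<in> sets borel"
    unfolding eq by auto
qed

lemma inverse_branch_measurable: "t \<in> T \<Longrightarrow> inverse_branch t \<in> unit_lebesgue \<rightarrow>\<^sub>M unit_lebesgue"
  using inverse_branch_in_U U_subset
  by (intro measurable_into_unit_lebesgue measurable_unit_lebesgue_if_borel inverse_branch_borel) blast+

text \<open>
  Injectivity turns the integral of the Jacobian into the measure of the image; that the image is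
  Borel comes from writing it as a preimage under the inverse branch.
\<close>
lemma nn_integral_jacobian:
  assumes t: "t \<in> T" and S: "S \<in> sets borel" "S \<subseteq> U t"
  shows "(\<integral>\<^sup>+x. ennreal \<bar>deriv f x\<bar> * indicator S x \<partial>lborel) = emeasure lborel (f ` S)"
proof -
  have im: "f ` S = f ` U t \<inter> inverse_branch t -` S"
    using S(2) inverse_branch_f[OF t] by (auto simp: f_inverse_branch)
  have "inverse_branch t -` S \<in> sets borel"
    using measurable_sets[OF inverse_branch_borel[OF t] S(1)] by simp
  then have fS: "f ` S \<in> sets borel"
    unfolding im using open_image[OF t U_open[OF t] order_refl] by auto
  have "f ` S \<subseteq> {0..1}" using S(2) U_subset[OF t] f_in_unit by blast
  then have "emeasure lborel (f ` S) \<le> emeasure lborel {0..1::real}"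
    by (intro emeasure_mono) auto
  then have fin: "emeasure lborel (f ` S) < \<infinity>" by (auto simp: le_less_trans)
  define r where "r = measure lborel (f ` S)"
  have r: "emeasure lborel (f ` S) = ennreal r" "0 \<le> r"
    using fin by (auto simp: r_def emeasure_eq_ennreal_measure)
  have "((\<lambda>_. 1::real) has_integral r) (f ` S)"
    using has_integral_iff_emeasure_lborel[OF fS r(2)] r(1) by simp
  then have "(\<lambda>_. 1::real) absolutely_integrable_on (f ` S) \<and> integral (f ` S) (\<lambda>_. 1::real) = r"
    by (auto intro!: nonnegative_absolutely_integrable_1)
  then have "(\<lambda>x. \<bar>deriv f x\<bar> * 1) absolutely_integrable_on S \<and> integral S (\<lambda>x. \<bar>deriv f x\<bar> * 1) = r"
    using S has_deriv[OF t] inj_on_subset[OF inj_on_branch[OF t] S(2)]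
    by (subst has_absolute_integral_change_of_variables_1')
       (auto intro: has_field_derivative_at_within)
  then have "((\<lambda>x. \<bar>deriv f x\<bar>) has_integral r) S"
    by (auto simp: has_integral_iff dest: set_lebesgue_integral_eq_integral(1))
  from nn_integral_has_integral_lebesgue'[OF _ this] show ?thesis
    using r by simp
qed

text \<open>The value 1 off the branches, a null set, gives \<open>jac_ge_1\<close> without exceptions.\<close>
definition jac :: "real \<Rightarrow> real" where
  "jac x = (if x \<in> branches then \<bar>deriv f x\<bar> else 1)"

lemma jac_ge_1: "1 \<le> jac x"
  using abs_deriv_ge_1 by (auto simp: jac_def)

lemma U_borel: "t \<in> T \<Longrightarrow> U t \<in> sets borel" using U_open by auto

lemma branches_open: "open branches" using U_open by auto

lemma jac_borel: "jac \<in> borel_measurable borel"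
proof -
  have "continuous_on branches (deriv f)"
    using U_open continuous_deriv by (intro continuous_on_open_UN) auto
  then have "(\<lambda>x. if x \<in> branches then \<bar>deriv f x\<bar> else 1) \<in> borel_measurable borel"
    using branches_open
    by (intro borel_measurable_continuous_on_if) (auto intro!: continuous_intros)
  then show ?thesis by (simp add: jac_def [abs_def])
qed

lemma jac_measurable [measurable]: "jac \<in> borel_measurable unit_lebesgue"
  by (intro measurable_unit_lebesgue_if_borel jac_borel)

lemma nn_integral_jac:
  assumes t: "t \<in> T" and A: "A \<in> sets unit_lebesgue"
  shows "(\<integral>\<^sup>+x. ennreal (jac x) * indicator (U t) x * indicator A x \<partial>unit_lebesgue)
    = emeasure lborel (f ` (U t \<inter> A))"
proof -
  have A': "A \<in> sets borel" "A \<subseteq> {0..1}" using sets_unit_lebesgueD[OF A] by auto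
  have "(\<integral>\<^sup>+x. ennreal (jac x) * indicator (U t) x * indicator A x \<partial>unit_lebesgue)
      = (\<integral>\<^sup>+x. ennreal (jac x) * indicator (U t) x * indicator A x * indicator {0..1} x \<partial>lborel)"
    unfolding unit_lebesgue_def by (rule nn_integral_restrict_space) auto
  also have "\<dots> = (\<integral>\<^sup>+x. ennreal \<bar>deriv f x\<bar> * indicator (U t \<inter> A) x \<partial>lborel)"
    using t A' by (intro nn_integral_cong) (auto simp: indicator_def jac_def)
  also have "\<dots> = emeasure lborel (f ` (U t \<inter> A))"
    using A' U_borel[OF t] by (intro nn_integral_jacobian[OF t]) auto
  finally show ?thesis .
qed

lemma image_measure_eq:
  assumes t: "t \<in> T"
  shows "distr (density unit_lebesgue (indicator (f ` U t))) unit_lebesgue (inverse_branch t)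
    = density unit_lebesgue (\<lambda>x. ennreal (jac x) * indicator (U t) x)" (is "?L = ?R")
proof (rule measure_eqI)
  fix A assume "A \<in> sets ?L"
  then have A: "A \<in> sets unit_lebesgue" by simp
  have V: "f ` U t \<in> sets unit_lebesgue"
    using open_image[OF t U_open[OF t] order_refl] U_subset[OF t] f_in_unit
    by (intro borel_subset_in_sets_unit_lebesgue) auto
  have Um: "U t \<in> sets unit_lebesgue"
    using U_borel[OF t] U_subset[OF t] by (intro borel_subset_in_sets_unit_lebesgue)
  have pre: "inverse_branch t -` A \<inter> {0..1} \<in> sets unit_lebesgue"
    using measurable_sets[OF inverse_branch_measurable[OF t] A] by simp
  have im: "f ` (U t \<inter> A) = f ` U t \<inter> (inverse_branch t -` A \<inter> {0..1})"
    using inverse_branch_f[OF t] f_in_unit U_subset[OF t] by auto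
  have "emeasure ?L A = emeasure (density unit_lebesgue (indicator (f ` U t))) (inverse_branch t -` A \<inter> {0..1})"
    using inverse_branch_measurable[OF t] A by (subst emeasure_distr) auto
  also have "\<dots> = (\<integral>\<^sup>+y. indicator (f ` (U t \<inter> A)) y \<partial>unit_lebesgue)"
    using V pre by (subst emeasure_density) (auto simp: im indicator_def simp del: nn_integral_indicator
        intro!: nn_integral_cong)
  also have "\<dots> = emeasure lborel (f ` (U t \<inter> A))"
    using V pre by (simp add: im emeasure_unit_lebesgue)
  also have "\<dots> = emeasure ?R A"
    using A Um by (subst emeasure_density) (simp_all add: nn_integral_jac[OF t A])
  finally show "emeasure ?L A = emeasure ?R A" .
qed simp

lemma nn_integral_jac_le_1:
  assumes t: "t \<in> T"
  shows "(\<integral>\<^sup>+x. ennreal (jac x) * indicator (U t) x \<partial>unit_lebesgue) \<le> 1"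
proof -
  have s: "{0..1::real} \<in> sets unit_lebesgue" by (intro borel_subset_in_sets_unit_lebesgue) auto
  have "(\<integral>\<^sup>+x. ennreal (jac x) * indicator (U t) x \<partial>unit_lebesgue)
      = (\<integral>\<^sup>+x. ennreal (jac x) * indicator (U t) x * indicator {0..1} x \<partial>unit_lebesgue)"
    by (intro nn_integral_cong) auto
  also have "\<dots> = emeasure lborel (f ` (U t \<inter> {0..1}))" by (rule nn_integral_jac[OF t s])
  also have "\<dots> \<le> emeasure lborel {0..1::real}"
    using f_in_unit by (intro emeasure_mono) auto
  finally show ?thesis by simp
qed

text \<open>
  The Jacobian itself is integrable, since it integrates to at most 1 over each of the finitely many
  branches, and \<open>0 \<le> ln j \<le> j\<close> for \<open>j \<ge> 1\<close>.
\<close>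
lemma integrable_ln_jac: "integrable unit_lebesgue (\<lambda>x. ln (jac x))"
proof -
  have Um: "U t \<in> sets unit_lebesgue" if "t \<in> T" for t
    using U_borel[OF that] U_subset[OF that] by (intro borel_subset_in_sets_unit_lebesgue)
  have "(\<integral>\<^sup>+x. ennreal (jac x) \<partial>unit_lebesgue)
      \<le> (\<integral>\<^sup>+x. (\<Sum>t\<in>T. ennreal (jac x) * indicator (U t) x) \<partial>unit_lebesgue)"
  proof (rule nn_integral_mono_AE, use AE_in_branches in eventually_elim)
    case (elim x)
    then obtain t where t: "t \<in> T" "x \<in> U t" by auto
    have "ennreal (jac x) * indicator (U t) x \<le> (\<Sum>t\<in>T. ennreal (jac x) * indicator (U t) x)"
      using t finite_T by (intro member_le_sum) auto
    then show ?case using t by simp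
  qed
  also have "\<dots> = (\<Sum>t\<in>T. \<integral>\<^sup>+x. ennreal (jac x) * indicator (U t) x \<partial>unit_lebesgue)"
  proof (rule nn_integral_sum)
    fix t assume "t \<in> T"
    note [measurable] = Um[OF this]
    show "(\<lambda>x. ennreal (jac x) * indicator (U t) x) \<in> borel_measurable unit_lebesgue"
      by measurable
  qed
  also have "\<dots> \<le> (\<Sum>t\<in>T. 1)" by (intro sum_mono nn_integral_jac_le_1)
  also have "\<dots> < \<infinity>" by (simp add: of_nat_less_top)
  finally have "(\<integral>\<^sup>+x. ennreal (jac x) \<partial>unit_lebesgue) < \<infinity>" .
  then have "integrable unit_lebesgue jac"
    using order_trans[OF zero_le_one jac_ge_1] by (intro integrableI_nonneg jac_measurable AE_I2)
  then show ?thesis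
  proof (rule Bochner_Integration.integrable_bound)
    show "AE x in unit_lebesgue. norm (ln (jac x)) \<le> norm (jac x)"
    proof (rule AE_I2)
      fix x show "norm (ln (jac x)) \<le> norm (jac x)"
        using jac_ge_1[of x] ln_le_minus_one[of "jac x"] by simp
    qed
  qed (rule borel_measurable_ln[OF jac_measurable])
qed

lemma AE_jac: "AE x in unit_lebesgue. jac x = \<bar>deriv f x\<bar>"
  using AE_in_branches by eventually_elim (simp add: jac_def)

lemma integrable_ln_abs_deriv:
  "integrable unit_lebesgue (\<lambda>x. ln \<bar>deriv f x\<bar>)"
  "(\<integral>x. ln \<bar>deriv f x\<bar> \<partial>unit_lebesgue) = (\<integral>x. ln (jac x) \<partial>unit_lebesgue)"
proof -
  have m: "(\<lambda>x. ln \<bar>deriv f x\<bar>) \<in> borel_measurable unit_lebesgue"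
  proof (rule measurable_discrete_difference[where f="\<lambda>x. ln (jac x)" and X="{0..1} - branches"])
    show "(\<lambda>x. ln (jac x)) \<in> borel_measurable unit_lebesgue"
      by (rule borel_measurable_ln[OF jac_measurable])
    show "countable ({0..1} - branches)" using finite_complement by (rule countable_finite)
    show "{x} \<in> sets unit_lebesgue" if "x \<in> {0..1} - branches" for x
      using that by (intro borel_subset_in_sets_unit_lebesgue) auto
  qed (auto simp: jac_def)
  have ae: "AE x in unit_lebesgue. ln \<bar>deriv f x\<bar> = ln (jac x)"
    using AE_jac by eventually_elim simp
  show "integrable unit_lebesgue (\<lambda>x. ln \<bar>deriv f x\<bar>)"
    by (rule integrable_cong_AE_imp[OF integrable_ln_jac m]) (use ae in \<open>eventually_elim, simp\<close>)
  show "(\<integral>x. ln \<bar>deriv f x\<bar> \<partial>unit_lebesgue) = (\<integral>x. ln (jac x) \<partial>unit_lebesgue)"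
    using m ae by (intro integral_cong_AE) auto
qed

lemma T_nonempty: "T \<noteq> {}"
proof
  assume "T = {}"
  then have "finite {0..1::real}" using finite_complement by simp
  then show False by (simp add: infinite_Icc)
qed

text \<open>
  At the finitely many points outside the branches the value is chosen such that the label is
  monotone on the whole line.  Then every sample has a monotone word of labels from left to right,
  whether or not it avoids these points.
\<close>
definition label :: "real \<Rightarrow> real" where
  "label x = Max (insert (Min T) {t \<in> T. \<exists>u\<in>U t. u \<le> x})"

lemma label_in_T: "label x \<in> T"
proof -
  have "label x \<in> insert (Min T) {t \<in> T. \<exists>u\<in>U t. u \<le> x}"
    unfolding label_def using finite_T by (intro Max_in) auto
  then show ?thesis using Min_in[OF finite_T T_nonempty] by auto
qed

lemma label_mono: "x \<le> y \<Longrightarrow> label x \<le> label y"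
  unfolding label_def using finite_T by (intro Max_mono) (auto intro: order_trans)

lemma label_eq:
  assumes t: "t \<in> T" and x: "x \<in> U t"
  shows "label x = t"
  unfolding label_def
proof (rule Max_eqI)
  fix s assume "s \<in> insert (Min T) {t \<in> T. \<exists>u\<in>U t. u \<le> x}"
  then consider "s = Min T" | u where "s \<in> T" "u \<in> U s" "u \<le> x" by auto
  then show "s \<le> t"
  proof cases
    case 2
    then show ?thesis using U_less[OF t 2(1) _ x 2(2)] by force
  qed (use t finite_T in simp)
qed (use t x finite_T in auto)

lemma in_U_label: "x \<in> branches \<Longrightarrow> x \<in> U (label x)"
  using label_eq by auto

lemma label_measurable: "label \<in> unit_lebesgue \<rightarrow>\<^sub>M count_space T"
proof -
  have "label \<in> borel_measurable borel"
    using label_mono by (intro borel_measurable_mono monoI)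
  then have b: "label \<in> borel_measurable unit_lebesgue"
    by (rule measurable_unit_lebesgue_if_borel)
  show ?thesis
    unfolding measurable_count_space_eq2[OF finite_T]
    using measurable_sets[OF b, of "{t}" for t] label_in_T by auto
qed

section \<open>Sampling from the permuton of the map\<close>

definition sample :: "nat \<Rightarrow> (nat \<Rightarrow> real) measure" where
  "sample n = (\<Pi>\<^sub>M i\<in>{1..n}. unit_lebesgue)"

definition graph_points :: "nat \<Rightarrow> (nat \<Rightarrow> real) \<Rightarrow> nat \<Rightarrow> real \<times> real" where
  "graph_points n X = compose {1..n} (\<lambda>x. (x, f x)) X"

definition perm_of_sample :: "nat \<Rightarrow> (nat \<Rightarrow> real) \<Rightarrow> nat \<Rightarrow> nat" where
  "perm_of_sample n X = sampled_perm n (graph_points n X)"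

lemma graph_points: "i \<in> {1..n} \<Longrightarrow> graph_points n X i = (X i, f (X i))"
  by (simp add: graph_points_def compose_eq)

lemma prob_space_sample: "prob_space (sample n)"
  unfolding sample_def by (intro prob_space_PiM prob_space_unit_lebesgue)

lemma measurable_coordinate: "i \<in> {1..n} \<Longrightarrow> (\<lambda>X. X i) \<in> sample n \<rightarrow>\<^sub>M unit_lebesgue"
  unfolding sample_def by (rule measurable_component_singleton)

lemma distr_coordinate:
  "i \<in> {1..n} \<Longrightarrow> distr (sample n) unit_lebesgue (\<lambda>X. X i) = unit_lebesgue"
  unfolding sample_def by (rule distr_PiM_component) (auto intro: prob_space_unit_lebesgue)

lemma integral_coordinate:
  fixes \<phi> :: "real \<Rightarrow> real"
  assumes "i \<in> {1..n}" and "integrable unit_lebesgue \<phi>"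
  shows "integrable (sample n) (\<lambda>X. \<phi> (X i))"
    and "(\<integral>X. \<phi> (X i) \<partial>sample n) = (\<integral>x. \<phi> x \<partial>unit_lebesgue)"
proof -
  note m = measurable_coordinate[OF assms(1)]
  have \<phi>: "\<phi> \<in> borel_measurable unit_lebesgue" using assms(2) by auto
  show "integrable (sample n) (\<lambda>X. \<phi> (X i))"
    using assms integrable_distr_eq[OF m \<phi>] by (simp add: distr_coordinate)
  show "(\<integral>X. \<phi> (X i) \<partial>sample n) = (\<integral>x. \<phi> x \<partial>unit_lebesgue)"
    using integral_distr[OF m \<phi>] assms by (simp add: distr_coordinate)
qed

lemma AE_sample_in_branches: "AE X in sample n. \<forall>i\<in>{1..n}. X i \<in> branches"
proof (rule AE_finite_allI)
  fix i assume i: "i \<in> {1..n}"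
  show "AE X in sample n. X i \<in> branches"
    unfolding sample_def by (rule AE_PiM_component[OF prob_space_unit_lebesgue i AE_in_branches])
qed simp

lemma permuton_of_map: "permuton (permuton_of f)"
  by (rule permuton_permuton_of[OF preserving])

lemma perm_law_eq:
  "perm_law n (permuton_of f) = distr (sample n) (count_space (Sym n)) (perm_of_sample n)"
  and perm_of_sample_measurable: "perm_of_sample n \<in> sample n \<rightarrow>\<^sub>M count_space (Sym n)"
proof -
  let ?\<mu> = "permuton_of f" and ?h = "\<lambda>x. (x, f x)"
  have p: "prob_space ?\<mu>" and s: "sets ?\<mu> = sets borel_square"
    using permuton_of_map by (auto simp: permuton_def)
  have h: "?h \<in> unit_lebesgue \<rightarrow>\<^sub>M ?\<mu>"
    using measurable_graph[OF f_measurable] by (simp add: measurable_cong_sets[OF refl s])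
  have "distr unit_lebesgue ?\<mu> ?h = ?\<mu>"
    unfolding permuton_of_def by (rule distr_cong) simp_all
  then have PiM: "(\<Pi>\<^sub>M i\<in>{1..n}. ?\<mu>) = distr (sample n) (\<Pi>\<^sub>M i\<in>{1..n}. ?\<mu>) (graph_points n)"
    unfolding sample_def graph_points_def [abs_def]
    using distr_PiM_finite_prob_space'[of "{1..n}" "\<lambda>_. unit_lebesgue" "\<lambda>_. ?\<mu>" ?h] p h
    by (simp add: prob_space_unit_lebesgue)
  have g: "graph_points n \<in> sample n \<rightarrow>\<^sub>M (\<Pi>\<^sub>M i\<in>{1..n}. ?\<mu>)"
    unfolding sample_def graph_points_def [abs_def] compose_def using h by measurable
  note sp = measurable_sampled_perm[OF s, of n]
  have comp: "sampled_perm n \<circ> graph_points n = perm_of_sample n"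
    by (auto simp: perm_of_sample_def)
  show "perm_law n ?\<mu> = distr (sample n) (count_space (Sym n)) (perm_of_sample n)"
    unfolding perm_law_def by (subst PiM, subst distr_distr[OF sp g]) (simp add: comp)
  show "perm_of_sample n \<in> sample n \<rightarrow>\<^sub>M count_space (Sym n)"
    using measurable_comp[OF g sp] by (simp add: comp)
qed

lemma permuton_entropy_eq_shannon:
  "permuton_entropy n (permuton_of f) = shannon_entropy (sample n) (perm_of_sample n) (Sym n)"
proof -
  have "measure (perm_law n (permuton_of f)) {\<sigma>}
      = measure (sample n) (perm_of_sample n -` {\<sigma>} \<inter> space (sample n))" if "\<sigma> \<in> Sym n" for \<sigma>
    unfolding perm_law_eq using that by (intro measure_distr[OF perm_of_sample_measurable]) simp
  then show ?thesis
    unfolding permuton_entropy_eq[OF permuton_of_map] shannon_entropy_def by simp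
qed

section \<open>Lower bound\<close>

text \<open>
  The heights fix the vertical ranks and the permutation turns these into horizontal ranks.  A
  horizontal rank picks its letter from the word, that is, the branch of the point, and on a branch
  the height determines the point.
\<close>
lemma coordinates_determined:
  assumes perm: "perm_of_sample n X = perm_of_sample n X'"
    and word: "word_by_rank n X (\<lambda>i. label (X i)) = word_by_rank n X' (\<lambda>i. label (X' i))"
    and eq: "\<And>i. i \<in> {1..n} \<Longrightarrow> f (X i) = f (X' i)"
    and br: "\<And>i. i \<in> {1..n} \<Longrightarrow> X i \<in> branches" "\<And>i. i \<in> {1..n} \<Longrightarrow> X' i \<in> branches"
    and i: "i \<in> {1..n}"
  shows "X i = X' i"
proof -
  have fst_rank: "rank_of n (\<lambda>i. fst (graph_points n Y i)) i = rank_of n Y i" for Y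
    using i by (intro rank_of_cong) (auto simp: graph_points)
  have "rank_of n X i = rank_of n X' i"
    using rank_of_fst_eq_of_sampled_perm[OF perm[unfolded perm_of_sample_def] i] eq
    by (simp add: fst_rank graph_points)
  then have "label (X i) = label (X' i)"
    using word_by_rank_rank_of[OF i, of X "\<lambda>i. label (X i)"]
      word_by_rank_rank_of[OF i, of X' "\<lambda>i. label (X' i)"] word by simp
  then show ?thesis
    using inj_onD[OF inj_on_branch[OF label_in_T] eq[OF i]] in_U_label[OF br(1)[OF i]]
      in_U_label[OF br(2)[OF i]] by simp
qed

text \<open>
  On a set on which \<open>f \<times> \<dots> \<times> f\<close> is injective, the Jacobian integrates to the volume of the image.
  Splitting according to the branches of the coordinates, each part is carried to the image by the
  product of inverse branches, and injectivity makes the images of the parts disjoint.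
\<close>
lemma nn_integral_jacobian_le_1:
  assumes E: "E \<in> sets (sample n)"
    and br: "\<And>X i. X \<in> E \<Longrightarrow> i \<in> {1..n} \<Longrightarrow> X i \<in> branches"
    and inj: "\<And>X X' i. X \<in> E \<Longrightarrow> X' \<in> E \<Longrightarrow> (\<And>i. i \<in> {1..n} \<Longrightarrow> f (X i) = f (X' i)) \<Longrightarrow>
      i \<in> {1..n} \<Longrightarrow> X i = X' i"
  shows "(\<integral>\<^sup>+X. (\<Prod>i\<in>{1..n}. ennreal (jac (X i))) * indicator E X \<partial>sample n) \<le> 1"
proof -
  let ?I = "{1..n}" and ?L = "{1..n} \<rightarrow>\<^sub>E T"
  interpret S: prob_space "sample n" by (rule prob_space_sample)
  have fin: "finite ?L" using finite_T by (intro finite_PiE) auto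
  have Um [measurable]: "U t \<in> sets unit_lebesgue" if "t \<in> T" for t
    using U_borel[OF that] U_subset[OF that] by (intro borel_subset_in_sets_unit_lebesgue)
  have Vm [measurable]: "f ` U t \<in> sets unit_lebesgue" if "t \<in> T" for t
    using open_image[OF that U_open[OF that] order_refl] U_subset[OF that] f_in_unit
    by (intro borel_subset_in_sets_unit_lebesgue) auto
  note [measurable] = inverse_branch_measurable
  define d where "d L i x = ennreal (jac x) * indicator (U (L i)) x" for L :: "nat \<Rightarrow> real" and i x
  define w where "w L i = (indicator (f ` U (L i)) :: real \<Rightarrow> ennreal)" for L :: "nat \<Rightarrow> real" and i
  define G where "G L Y = (\<lambda>i\<in>?I. inverse_branch (L i) (Y i))" for L Y :: "nat \<Rightarrow> real"
  have LT: "L i \<in> T" if "L \<in> ?L" "i \<in> ?I" for L i using that by auto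
  have dm [measurable]: "d L i \<in> borel_measurable unit_lebesgue" if "L \<in> ?L" "i \<in> ?I" for L i
    unfolding d_def using LT[OF that] by measurable
  have wm [measurable]: "w L i \<in> borel_measurable unit_lebesgue" if "L \<in> ?L" "i \<in> ?I" for L i
    unfolding w_def using LT[OF that] by measurable
  have iE [measurable]: "(indicator E :: _ \<Rightarrow> ennreal) \<in> borel_measurable (sample n)"
    using E by measurable
  have Gm: "G L \<in> sample n \<rightarrow>\<^sub>M sample n" if "L \<in> ?L" for L
    unfolding sample_def G_def [abs_def] using LT[OF that] by measurable
  have pm: "(\<lambda>X. \<Prod>i\<in>?I. h i (X i)) \<in> borel_measurable (sample n)"
    if "\<And>i. i \<in> ?I \<Longrightarrow> h i \<in> borel_measurable unit_lebesgue" for h :: "nat \<Rightarrow> real \<Rightarrow> ennreal"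
    using that measurable_compose[OF measurable_coordinate] by (intro borel_measurable_prod_ennreal) blast
  have "(\<integral>\<^sup>+X. (\<Prod>i\<in>?I. ennreal (jac (X i))) * indicator E X \<partial>sample n)
      \<le> (\<integral>\<^sup>+X. (\<Sum>L\<in>?L. (\<Prod>i\<in>?I. d L i (X i)) * indicator E X) \<partial>sample n)"
  proof (rule nn_integral_mono)
    fix X
    show "(\<Prod>i\<in>?I. ennreal (jac (X i))) * indicator E X
        \<le> (\<Sum>L\<in>?L. (\<Prod>i\<in>?I. d L i (X i)) * indicator E X)"
    proof (cases "X \<in> E")
      case True
      define L where "L = (\<lambda>i\<in>?I. label (X i))"
      have L: "L \<in> ?L" using label_in_T by (auto simp: L_def)
      have "(\<Prod>i\<in>?I. ennreal (jac (X i))) = (\<Prod>i\<in>?I. d L i (X i))"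
        using in_U_label[OF br[OF True]] by (intro prod.cong) (auto simp: d_def L_def)
      moreover have "(\<Prod>i\<in>?I. d L i (X i)) * indicator E X
          \<le> (\<Sum>L\<in>?L. (\<Prod>i\<in>?I. d L i (X i)) * indicator E X)"
        using L fin by (intro member_le_sum) auto
      ultimately show ?thesis by simp
    qed simp
  qed
  also have "\<dots> = (\<Sum>L\<in>?L. \<integral>\<^sup>+X. (\<Prod>i\<in>?I. d L i (X i)) * indicator E X \<partial>sample n)"
    using pm[OF dm] iE by (intro nn_integral_sum borel_measurable_times_ennreal)
  also have "\<dots> = (\<Sum>L\<in>?L. \<integral>\<^sup>+Y. (\<Prod>i\<in>?I. w L i (Y i)) * indicator E (G L Y) \<partial>sample n)"
  proof (rule sum.cong[OF refl])
    fix L assume L: "L \<in> ?L"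
    show "(\<integral>\<^sup>+X. (\<Prod>i\<in>?I. d L i (X i)) * indicator E X \<partial>sample n)
        = (\<integral>\<^sup>+Y. (\<Prod>i\<in>?I. w L i (Y i)) * indicator E (G L Y) \<partial>sample n)"
      unfolding sample_def G_def
    proof (rule nn_integral_PiM_change_of_variables[OF prob_space_unit_lebesgue])
      fix i assume i: "i \<in> ?I"
      show "(\<integral>\<^sup>+x. d L i x \<partial>unit_lebesgue) < \<infinity>"
        using nn_integral_jac_le_1[OF LT[OF L i]] unfolding d_def
        by (auto intro: le_less_trans)
      show "distr (density unit_lebesgue (w L i)) unit_lebesgue (inverse_branch (L i))
          = density unit_lebesgue (d L i)"
        unfolding d_def [abs_def] w_def by (rule image_measure_eq[OF LT[OF L i]])
    qed (use L LT inverse_branch_measurable dm wm iE in \<open>auto simp: sample_def\<close>)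
  qed
  also have "\<dots> = (\<integral>\<^sup>+Y. (\<Sum>L\<in>?L. (\<Prod>i\<in>?I. w L i (Y i)) * indicator E (G L Y)) \<partial>sample n)"
    using pm[OF wm] measurable_compose[OF Gm iE]
    by (intro nn_integral_sum[symmetric] borel_measurable_times_ennreal)
  also have "\<dots> \<le> (\<integral>\<^sup>+Y. 1 \<partial>sample n)"
  proof (rule nn_integral_mono)
    fix Y
    \<comment> \<open>the inverse branches of \<open>Y\<close> along \<open>L\<close> form the preimage of \<open>Y\<close> in \<open>E\<close> with labels \<open>L\<close>, so
      injectivity leaves at most one \<open>L\<close> with \<open>h L \<noteq> 0\<close>\<close>
    define h where "h L = ((\<Prod>i\<in>?I. w L i (Y i)) * indicator E (G L Y) :: ennreal)" for L
    have nz: "G L Y \<in> E" "h L = 1" "\<And>i. i \<in> ?I \<Longrightarrow> Y i \<in> f ` U (L i)" if "h L \<noteq> 0" for L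
    proof -
      show E: "G L Y \<in> E" using that by (auto simp: h_def indicator_def split: if_splits)
      have "w L i (Y i) \<noteq> 0" if "i \<in> ?I" for i
        using \<open>h L \<noteq> 0\<close> that by (auto simp: h_def)
      then show "\<And>i. i \<in> ?I \<Longrightarrow> Y i \<in> f ` U (L i)"
        by (auto simp: w_def indicator_def split: if_splits)
      then show "h L = 1" using E by (simp add: h_def w_def)
    qed
    have unique: "L = L'" if L: "L \<in> ?L" "h L \<noteq> 0" and L': "L' \<in> ?L" "h L' \<noteq> 0" for L L'
    proof (rule PiE_ext[OF L(1) L'(1)])
      fix i assume i: "i \<in> ?I"
      have fG: "f (G L Y i) = Y i" "f (G L' Y i) = Y i" if "i \<in> ?I" for i
        using nz(3)[OF L(2) that] nz(3)[OF L'(2) that] that by (simp_all add: G_def f_inverse_branch)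
      have "G L Y i = G L' Y i"
        using inj[OF nz(1)[OF L(2)] nz(1)[OF L'(2)] _ i] fG by simp
      moreover have "label (G L Y i) = L i" "label (G L' Y i) = L' i"
        using i LT[OF L(1) i] LT[OF L'(1) i] by (auto simp: G_def intro!: label_eq inverse_branch_in_U)
      ultimately show "L i = L' i" by simp
    qed
    have "(\<Sum>L\<in>?L. h L) \<le> 1"
    proof (cases "\<exists>L\<in>?L. h L \<noteq> 0")
      case True
      then obtain L where L: "L \<in> ?L" "h L \<noteq> 0" by blast
      have "sum h (?L - {L}) = 0" using unique[OF L] by (intro sum.neutral) blast
      then show ?thesis using sum.remove[OF fin L(1), of h] nz(2)[OF L(2)] by simp
    qed simp
    then show "(\<Sum>L\<in>?L. (\<Prod>i\<in>?I. w L i (Y i)) * indicator E (G L Y)) \<le> 1"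
      by (simp add: h_def)
  qed
  finally show ?thesis by (simp add: S.emeasure_space_1)
qed

text \<open>
  Given the permutation, the word of labels from left to right makes the heights determine the
  sample, and this word is monotone.  So \<open>f \<times> \<dots> \<times> f\<close> is at most \<open>(n + 1) ^ card T\<close> to one on the
  samples with a given permutation.
\<close>
lemma entropy_ge:
  "permuton_entropy n (permuton_of f)
    \<ge> real n * (\<integral>x. ln (jac x) \<partial>unit_lebesgue) - card T * ln (real n + 1)"
proof -
  let ?I = "{1..n}"
  interpret S: prob_space "sample n" by (rule prob_space_sample)
  define W where "W = {w \<in> ?I \<rightarrow>\<^sub>E T. mono_on ?I w}"
  have W: "finite W" "card W \<le> (n + 1) ^ card T"
    unfolding W_def by (rule card_monotone_words[OF finite_T])+
  define word where "word X = word_by_rank n X (\<lambda>i. label (X i))" for X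
  have word_W: "word X \<in> W" for X
    unfolding word_def W_def
    by (intro CollectI conjI word_by_rank_in_PiE mono_on_word_by_rank label_in_T label_mono)
  have coord: "(\<lambda>X. X i) \<in> borel_measurable (sample n)" if "i \<in> ?I" for i
    by (rule measurable_compose[OF measurable_coordinate[OF that] borel_measurable_ident_unit_lebesgue])
  have word_m: "word \<in> sample n \<rightarrow>\<^sub>M count_space (?I \<rightarrow>\<^sub>E T)"
    unfolding word_def [abs_def]
    using coord finite_T measurable_compose[OF measurable_coordinate label_measurable]
    by (intro measurable_word_by_rank)
  have br: "{X \<in> space (sample n). \<forall>i\<in>?I. X i \<in> branches} \<in> sets (sample n)"
  proof (intro sets.sets_Collect_finite_All)
    fix i assume i: "i \<in> ?I"
    have "(\<lambda>X. X i) -` branches \<inter> space (sample n) \<in> sets (sample n)"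
      using branches_open by (intro measurable_sets[OF coord[OF i]]) auto
    moreover have "{X \<in> space (sample n). X i \<in> branches} = (\<lambda>X. X i) -` branches \<inter> space (sample n)"
      by auto
    ultimately show "{X \<in> space (sample n). X i \<in> branches} \<in> sets (sample n)" by simp
  qed simp
  define d where "d X = (\<Prod>i\<in>?I. jac (X i))" for X :: "nat \<Rightarrow> real"
  have jac_pos: "0 < jac x" for x using less_le_trans[OF zero_less_one jac_ge_1] .
  have jm: "(\<lambda>X. jac (X i)) \<in> borel_measurable (sample n)" if "i \<in> ?I" for i
    by (rule measurable_compose[OF measurable_coordinate[OF that] jac_measurable])
  have ln_d: "ln (d X) = (\<Sum>i\<in>?I. ln (jac (X i)))" for X
    unfolding d_def using jac_pos less_irrefl by (intro ln_prod) (auto, metis less_irrefl)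
  note lc = integral_coordinate[OF _ integrable_ln_jac]
  have "S.expectation (\<lambda>X. ln (d X)) - ln ((real n + 1) ^ card T)
      \<le> shannon_entropy (sample n) (perm_of_sample n) (Sym n)"
  proof (rule S.shannon_entropy_ge_log_density[OF finite_Sym perm_of_sample_measurable])
    show "d \<in> borel_measurable (sample n)"
      unfolding d_def [abs_def] using jm by (intro borel_measurable_prod)
    show "AE X in sample n. 0 < d X" using jac_pos by (auto simp: d_def intro!: prod_pos)
    show "integrable (sample n) (\<lambda>X. ln (d X))"
      unfolding ln_d by (intro Bochner_Integration.integrable_sum lc(1))
    fix \<sigma> assume \<sigma>: "\<sigma> \<in> Sym n"
    define E where "E a = (perm_of_sample n -` {\<sigma>} \<inter> space (sample n)) \<inter> (word -` {a} \<inter> space (sample n))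
        \<inter> {X \<in> space (sample n). \<forall>i\<in>?I. X i \<in> branches}" for a
    have Em: "E a \<in> sets (sample n)" if "a \<in> W" for a
      unfolding E_def using that \<sigma> br
      by (intro sets.Int measurable_sets[OF word_m] measurable_sets[OF perm_of_sample_measurable])
         (auto simp: W_def)
    have dm: "(\<lambda>X. \<Prod>i\<in>?I. ennreal (jac (X i))) \<in> borel_measurable (sample n)"
      using jm by (intro borel_measurable_prod_ennreal measurable_compose[OF _ measurable_ennreal])
    have "(\<integral>\<^sup>+X. ennreal (d X) * indicator (perm_of_sample n -` {\<sigma>} \<inter> space (sample n)) X \<partial>sample n)
        \<le> (\<integral>\<^sup>+X. (\<Sum>a\<in>W. (\<Prod>i\<in>?I. ennreal (jac (X i))) * indicator (E a) X) \<partial>sample n)"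
    proof (rule nn_integral_mono_AE, use AE_sample_in_branches AE_space in eventually_elim)
      case (elim X)
      have d: "ennreal (d X) = (\<Prod>i\<in>?I. ennreal (jac (X i)))"
        unfolding d_def using jac_pos less_imp_le by (intro prod_ennreal[symmetric]) blast
      show ?case
      proof (cases "perm_of_sample n X = \<sigma>")
        case True
        have "(\<Prod>i\<in>?I. ennreal (jac (X i))) * indicator (E (word X)) X
            \<le> (\<Sum>a\<in>W. (\<Prod>i\<in>?I. ennreal (jac (X i))) * indicator (E a) X)"
          using W(1) word_W by (intro member_le_sum) auto
        moreover have "X \<in> E (word X)" using True elim by (auto simp: E_def)
        ultimately show ?thesis using True elim by (simp add: d)
      qed simp
    qed
    also have "\<dots> = (\<Sum>a\<in>W. \<integral>\<^sup>+X. (\<Prod>i\<in>?I. ennreal (jac (X i))) * indicator (E a) X \<partial>sample n)"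
      using dm Em by (intro nn_integral_sum borel_measurable_times_ennreal borel_measurable_indicator)
    also have "\<dots> \<le> (\<Sum>a\<in>W. 1)"
    proof (rule sum_mono)
      fix a assume "a \<in> W"
      then show "(\<integral>\<^sup>+X. (\<Prod>i\<in>?I. ennreal (jac (X i))) * indicator (E a) X \<partial>sample n) \<le> 1"
      proof (rule nn_integral_jacobian_le_1[OF Em])
        fix X X' i assume "X \<in> E a" "X' \<in> E a" "i \<in> ?I"
          and "\<And>i. i \<in> ?I \<Longrightarrow> f (X i) = f (X' i)"
        then show "X i = X' i"
          by (intro coordinates_determined[of n X X' i]) (auto simp: E_def word_def)
      qed (auto simp: E_def)
    qed
    also have "\<dots> = ennreal (real (card W))" by (simp add: ennreal_of_nat_eq_real_of_nat)
    also have "\<dots> \<le> ennreal ((real n + 1) ^ card T)"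
    proof (rule ennreal_leI)
      have "real (card W) \<le> real ((n + 1) ^ card T)" using W(2) by (rule of_nat_mono)
      then show "real (card W) \<le> (real n + 1) ^ card T" by (simp add: add.commute)
    qed
    finally show "(\<integral>\<^sup>+X. ennreal (d X) * indicator (perm_of_sample n -` {\<sigma>} \<inter> space (sample n)) X \<partial>sample n)
        \<le> ennreal ((real n + 1) ^ card T)" .
  qed simp
  moreover have "S.expectation (\<lambda>X. ln (d X)) = real n * (\<integral>x. ln (jac x) \<partial>unit_lebesgue)"
    unfolding ln_d by (subst Bochner_Integration.integral_sum) (simp_all add: lc)
  ultimately show ?thesis
    by (simp add: permuton_entropy_eq_shannon ln_realpow)
qed

section \<open>Upper bound\<close>

text \<open>The height 1 has the cell \<open>m\<close> to itself, so the unit interval meets \<open>m + 1\<close> cells.\<close>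
definition cell :: "nat \<Rightarrow> real \<Rightarrow> nat" where
  "cell m y = nat \<lfloor>real m * y\<rfloor>"

lemma cell_le: "y \<in> {0..1} \<Longrightarrow> cell m y \<le> m"
proof -
  assume "y \<in> {0..1}"
  then have "real m * y \<le> real m" by (simp add: mult_left_le)
  then show "cell m y \<le> m" unfolding cell_def by linarith
qed

lemma cell_mono: "y \<le> y' \<Longrightarrow> cell m y \<le> cell m y'"
  unfolding cell_def by (intro nat_mono floor_mono mult_left_mono) auto

lemma cell_eq_iff:
  assumes "m > 0" "0 \<le> y"
  shows "cell m y = c \<longleftrightarrow> real c / real m \<le> y \<and> y < (real c + 1) / real m"
proof -
  have "cell m y = c \<longleftrightarrow> \<lfloor>real m * y\<rfloor> = int c"
    using assms by (auto simp: cell_def)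
  also have "\<dots> \<longleftrightarrow> real c \<le> real m * y \<and> real m * y < real c + 1"
    by (simp add: floor_eq_iff)
  also have "\<dots> \<longleftrightarrow> real c / real m \<le> y \<and> y < (real c + 1) / real m"
    using assms by (simp add: field_simps)
  finally show ?thesis .
qed

lemma cell_measurable: "(\<lambda>x. cell m (f x)) \<in> unit_lebesgue \<rightarrow>\<^sub>M count_space {..m}"
proof -
  have b: "(\<lambda>x. real (cell m (f x))) \<in> borel_measurable unit_lebesgue"
  proof -
    have "(\<lambda>y. real (cell m y)) \<in> borel_measurable borel"
      using cell_mono by (intro borel_measurable_mono monoI) simp
    from measurable_compose[OF f_borel this] show ?thesis .
  qed
  have "(\<lambda>x. cell m (f x)) -` {c} \<inter> space unit_lebesgue \<in> sets unit_lebesgue" for c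
  proof -
    have "(\<lambda>x. cell m (f x)) -` {c} = (\<lambda>x. real (cell m (f x))) -` {real c}" by auto
    then show ?thesis using measurable_sets[OF b, of "{real c}"] by simp
  qed
  then show ?thesis
    unfolding measurable_count_space_eq2[OF finite_atMost] using cell_le f_in_unit by auto
qed

lemma cell_label_measurable:
  "(\<lambda>x. (cell m (f x), label x)) \<in> unit_lebesgue \<rightarrow>\<^sub>M count_space ({..m} \<times> T)"
proof -
  have "(\<lambda>x. (cell m (f x), label x)) \<in> unit_lebesgue \<rightarrow>\<^sub>M count_space {..m} \<Otimes>\<^sub>M count_space T"
    by (intro measurable_Pair cell_measurable label_measurable)
  also have "count_space {..m} \<Otimes>\<^sub>M count_space T = count_space ({..m} \<times> T)"
    using finite_T by (intro pair_measure_count_space) (auto intro: countable_finite)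
  finally show ?thesis .
qed

text \<open>
  The labels read in the order of heights determine the horizontal ranks and so the permutation,
  and any sub-probability on such words bounds the entropy by its expected code length.  Coding the
  label \<open>t\<close> of a point with height in the cell \<open>c\<close> by the weights \<open>v c\<close> costs \<open>- ln (v c t)\<close>; the
  cells themselves, read in the order of heights, form a monotone word and cost only \<open>O(ln n)\<close>.
\<close>
lemma entropy_le:
  fixes v :: "nat \<Rightarrow> real \<Rightarrow> real"
  assumes v: "\<And>c t. 0 < v c t" and sum_v: "\<And>c. (\<Sum>t\<in>T. v c t) \<le> 1"
  shows "permuton_entropy n (permuton_of f)
    \<le> (real m + 1) * ln (real n + 1) + real n * (\<integral>x. - ln (v (cell m (f x)) (label x)) \<partial>unit_lebesgue)"
proof -
  let ?I = "{1..n}"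
  interpret L: prob_space unit_lebesgue by (rule prob_space_unit_lebesgue)
  interpret S: prob_space "sample n" by (rule prob_space_sample)
  define Wc where "Wc = {w \<in> ?I \<rightarrow>\<^sub>E {..m}. mono_on ?I w}"
  define W where "W = Wc \<times> (?I \<rightarrow>\<^sub>E T)"
  have Wc: "finite Wc" "card Wc \<le> (n + 1) ^ (m + 1)"
    using card_monotone_words[of "{..m}" n] by (simp_all add: Wc_def)
  have fT: "finite (?I \<rightarrow>\<^sub>E T)" using finite_T by (intro finite_PiE) auto
  have W: "finite W" using Wc fT by (simp add: W_def)
  define zc where "zc X = word_by_rank n (\<lambda>i. f (X i)) (\<lambda>i. cell m (f (X i)))" for X
  define zt where "zt X = word_by_rank n (\<lambda>i. f (X i)) (\<lambda>i. label (X i))" for X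
  define Z where "Z X = (zc X, zt X)" for X
  have fm: "(\<lambda>X. f (X i)) \<in> borel_measurable (sample n)" if "i \<in> ?I" for i
    by (rule measurable_compose[OF measurable_coordinate[OF that] f_borel])
  have zc_m: "zc \<in> sample n \<rightarrow>\<^sub>M count_space (?I \<rightarrow>\<^sub>E {..m})"
    unfolding zc_def [abs_def]
    using fm measurable_compose[OF measurable_coordinate cell_measurable]
    by (intro measurable_word_by_rank) auto
  have zt_m: "zt \<in> sample n \<rightarrow>\<^sub>M count_space (?I \<rightarrow>\<^sub>E T)"
    unfolding zt_def [abs_def]
    using fm finite_T measurable_compose[OF measurable_coordinate label_measurable]
    by (intro measurable_word_by_rank)
  have Z_W: "Z X \<in> W" if "X \<in> space (sample n)" for X
  proof -
    have "zc X \<in> ?I \<rightarrow>\<^sub>E {..m}" "zt X \<in> ?I \<rightarrow>\<^sub>E T"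
      using measurable_space[OF zc_m that] measurable_space[OF zt_m that] by auto
    moreover have "mono_on ?I (zc X)"
      unfolding zc_def using cell_mono by (intro mono_on_word_by_rank) auto
    ultimately show ?thesis by (simp add: Z_def W_def Wc_def)
  qed
  have Z_m: "Z \<in> sample n \<rightarrow>\<^sub>M count_space W"
    unfolding measurable_count_space_eq2[OF W]
  proof (intro conjI ballI funcsetI Z_W)
    fix w assume w: "w \<in> W"
    have "Z -` {w} \<inter> space (sample n)
        = (zc -` {fst w} \<inter> space (sample n)) \<inter> (zt -` {snd w} \<inter> space (sample n))"
      by (auto simp: Z_def)
    also have "\<dots> \<in> sets (sample n)"
      using w by (intro sets.Int measurable_sets[OF zc_m] measurable_sets[OF zt_m]) (auto simp: W_def Wc_def)
    finally show "Z -` {w} \<inter> space (sample n) \<in> sets (sample n)" .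
  qed
  \<comment> \<open>a uniformly chosen monotone word of cells, followed by independent letters with the weights
    of their cells\<close>
  define K where "K = (real n + 1) ^ (m + 1)"
  have K: "0 < K" by (simp add: K_def)
  define q where "q w = (\<Prod>j\<in>?I. v (fst w j) (snd w j)) / K" for w :: "(nat \<Rightarrow> nat) \<times> (nat \<Rightarrow> real)"
  have q_pos: "0 < q w" for w using v K by (auto simp: q_def intro!: prod_pos divide_pos_pos)
  have "(\<Sum>w\<in>W. q w) = (\<Sum>c\<in>Wc. \<Sum>b\<in>?I \<rightarrow>\<^sub>E T. (\<Prod>j\<in>?I. v (c j) (b j)) / K)"
    unfolding W_def q_def by (subst sum.cartesian_product) (simp add: case_prod_beta)
  also have "\<dots> = (\<Sum>c\<in>Wc. (\<Prod>j\<in>?I. \<Sum>t\<in>T. v (c j) t) / K)"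
    using finite_T by (subst prod_sum_PiE) (auto simp: sum_divide_distrib)
  also have "\<dots> \<le> (\<Sum>c\<in>Wc. 1 / K)"
    using K sum_v v by (intro sum_mono divide_right_mono prod_le_1) (auto intro!: sum_nonneg intro: less_imp_le)
  also have "\<dots> = real (card Wc) / K" by simp
  also have "\<dots> \<le> 1"
  proof -
    have "real (card Wc) \<le> real ((n + 1) ^ (m + 1))" using Wc(2) by (rule of_nat_mono)
    also have "\<dots> = K" by (simp add: K_def algebra_simps)
    finally show ?thesis using K by simp
  qed
  finally have q_sum: "(\<Sum>w\<in>W. q w) \<le> 1" .
  define good where "good = {X. (\<forall>i\<in>?I. X i \<in> branches) \<and> inj_on X ?I}"
  have good_AE: "AE X in sample n. X \<in> good"
    using AE_sample_in_branches AE_PiM_inj_on[OF prob_space_unit_lebesgue finite_atLeastAtMost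
        AE_unit_lebesgue_pair_distinct, of 1 n]
    unfolding sample_def[symmetric] good_def by eventually_elim simp
  have det: "perm_of_sample n X = perm_of_sample n X'"
    if X: "X \<in> good" "X' \<in> good" and eq: "Z X = Z X'" for X X'
    unfolding perm_of_sample_def
  proof (rule sampled_perm_eqI_ranks)
    fix i i' assume i: "i \<in> ?I" "i' \<in> ?I"
    have fst_rank: "rank_of n (\<lambda>i. fst (graph_points n Y i)) i = rank_of n Y i"
      and snd_rank: "rank_of n (\<lambda>i. snd (graph_points n Y i)) i = rank_of n (\<lambda>i. f (Y i)) i"
      if "i \<in> ?I" for Y i
      using that by (auto intro!: rank_of_cong simp: graph_points)
    assume "rank_of n (\<lambda>i. snd (graph_points n X i)) i = rank_of n (\<lambda>i. snd (graph_points n X' i)) i'"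
    then have r: "rank_of n (\<lambda>i. f (X i)) i = rank_of n (\<lambda>i. f (X' i)) i'"
      using i by (simp add: snd_rank)
    have b: "word_by_rank n (\<lambda>i. f (X i)) (\<lambda>i. label (X i)) = word_by_rank n (\<lambda>i. f (X' i)) (\<lambda>i. label (X' i))"
      using eq by (simp add: Z_def zt_def)
    have "rank_of n Y i = card {j \<in> ?I.
        word_by_rank n (\<lambda>i. f (Y i)) (\<lambda>i. label (Y i)) j
          < word_by_rank n (\<lambda>i. f (Y i)) (\<lambda>i. label (Y i)) (rank_of n (\<lambda>i. f (Y i)) i) \<or>
        (word_by_rank n (\<lambda>i. f (Y i)) (\<lambda>i. label (Y i)) j
          = word_by_rank n (\<lambda>i. f (Y i)) (\<lambda>i. label (Y i)) (rank_of n (\<lambda>i. f (Y i)) i) \<and>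
         (if word_by_rank n (\<lambda>i. f (Y i)) (\<lambda>i. label (Y i)) j \<in> decreasing
          then rank_of n (\<lambda>i. f (Y i)) i \<le> j else j \<le> rank_of n (\<lambda>i. f (Y i)) i))}"
      if Y: "Y \<in> good" and i: "i \<in> ?I" for Y i
    proof (rule rank_of_eq_of_word[OF _ _ _ _ i])
      have br: "Y i \<in> U (label (Y i))" if "i \<in> ?I" for i
        using Y that in_U_label by (auto simp: good_def)
      show "Y k < Y i" if "i \<in> ?I" "k \<in> ?I" "label (Y k) < label (Y i)" for i k
        using U_less[OF label_in_T label_in_T that(3) br[OF that(2)] br[OF that(1)]] .
      show "f (Y k) < f (Y i) \<longleftrightarrow> Y k < Y i"
        if "i \<in> ?I" "k \<in> ?I" "label (Y k) = label (Y i)" "label (Y i) \<notin> decreasing" for i k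
        using f_less_iff(1)[OF label_in_T _ br[OF that(1)] that(4)] br[OF that(2)] that(3) by simp
      show "f (Y k) < f (Y i) \<longleftrightarrow> Y i < Y k"
        if "i \<in> ?I" "k \<in> ?I" "label (Y k) = label (Y i)" "label (Y i) \<in> decreasing" for i k
        using f_less_iff(2)[OF label_in_T _ br[OF that(1)] that(4)] br[OF that(2)] that(3) by simp
      show "inj_on Y ?I" using Y by (simp add: good_def)
    qed
    from this[OF X(1) i(1)] this[OF X(2) i(2)] have "rank_of n X i = rank_of n X' i'"
      by (simp add: b r)
    then show "rank_of n (\<lambda>i. fst (graph_points n X i)) i = rank_of n (\<lambda>i. fst (graph_points n X' i)) i'"
      using i by (simp add: fst_rank)
  qed
  define \<phi> where "\<phi> x = ln (v (cell m (f x)) (label x))" for x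
  have \<phi>_int: "integrable unit_lebesgue \<phi>"
    using L.expectation_finite_valued(1)[OF _ cell_label_measurable, where h = "\<lambda>(c, t). ln (v c t)"] finite_T
    by (simp add: \<phi>_def [abs_def])
  have ln_q: "- ln (q (Z X)) = (real m + 1) * ln (real n + 1) + (\<Sum>i\<in>?I. - \<phi> (X i))" for X
  proof -
    have "(\<Prod>j\<in>?I. v (zc X j) (zt X j)) = (\<Prod>i\<in>?I. v (cell m (f (X i))) (label (X i)))"
      unfolding zc_def zt_def by (rule prod_word_by_rank)
    then have "q (Z X) = (\<Prod>i\<in>?I. v (cell m (f (X i))) (label (X i))) / K"
      by (simp add: q_def Z_def)
    moreover have "0 < (\<Prod>i\<in>?I. v (cell m (f (X i))) (label (X i)))" using v by (intro prod_pos) auto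
    ultimately have "ln (q (Z X)) = (\<Sum>i\<in>?I. \<phi> (X i)) - ln K"
      using K v unfolding \<phi>_def by (subst ln_prod[symmetric]) (auto simp: ln_div less_imp_neq[symmetric])
    also have "ln K = (real m + 1) * ln (real n + 1)"
      unfolding K_def by (subst ln_realpow) (simp_all add: add.commute)
    finally show ?thesis by (simp add: sum_negf)
  qed
  have "shannon_entropy (sample n) (perm_of_sample n) (Sym n) \<le> S.expectation (\<lambda>X. - ln (q (Z X)))"
    by (rule S.shannon_entropy_le_code_length[OF finite_Sym perm_of_sample_measurable W Z_m good_AE
          det q_pos q_sum])
  also have "\<dots> = (real m + 1) * ln (real n + 1) + (\<Sum>i\<in>?I. S.expectation (\<lambda>X. - \<phi> (X i)))"
  proof -
    have "integrable (sample n) (\<lambda>X. - \<phi> (X i))" if "i \<in> ?I" for i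
      using integral_coordinate(1)[OF that \<phi>_int] by simp
    then show ?thesis
      unfolding ln_q
      by (subst Bochner_Integration.integral_add)
         (auto intro!: Bochner_Integration.integrable_sum Bochner_Integration.integral_sum simp: S.prob_space)
  qed
  also have "\<dots> = (real m + 1) * ln (real n + 1) + real n * (\<integral>x. - \<phi> x \<partial>unit_lebesgue)"
    by (simp add: integral_coordinate(2)[OF _ \<phi>_int])
  finally show ?thesis by (simp add: permuton_entropy_eq_shannon \<phi>_def)
qed

section \<open>Choosing the weights\<close>

definition piece :: "nat \<Rightarrow> nat \<Rightarrow> real \<Rightarrow> real set" where
  "piece m c t = {x \<in> {0..1}. cell m (f x) = c \<and> label x = t}"

lemma piece_measurable: "t \<in> T \<Longrightarrow> piece m c t \<in> sets unit_lebesgue"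
proof -
  assume t: "t \<in> T"
  have "{x \<in> space unit_lebesgue. cell m (f x) = c} \<in> sets unit_lebesgue"
  proof (cases "c \<le> m")
    case True
    then show ?thesis
      using measurable_sets[OF cell_measurable, of "{c}" m]
      by (auto simp: vimage_def Int_def conj_commute)
  next
    case False
    then have "{x \<in> space unit_lebesgue. cell m (f x) = c} = {}"
      using cell_le[OF f_in_unit, of _ m] by auto
    then show ?thesis by (metis sets.empty_sets)
  qed
  moreover have "{x \<in> space unit_lebesgue. label x = t} \<in> sets unit_lebesgue"
    using measurable_sets[OF label_measurable, of "{t}"] t
    by (auto simp: vimage_def Int_def conj_commute)
  moreover have "piece m c t
      = {x \<in> space unit_lebesgue. cell m (f x) = c} \<inter> {x \<in> space unit_lebesgue. label x = t}"
    by (auto simp: piece_def)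
  ultimately show ?thesis by (simp only: sets.Int)
qed

text \<open>The pieces over one cell fill at most its preimage, which has the measure of the cell
  and so at most \<open>1 / m\<close>.\<close>
lemma sum_measure_piece_le:
  assumes m: "m > 0"
  shows "real m * (\<Sum>t\<in>T. measure unit_lebesgue (piece m c t)) \<le> 1"
proof -
  interpret L: prob_space unit_lebesgue by (rule prob_space_unit_lebesgue)
  define B where "B = {real c / real m..(real c + 1) / real m} \<inter> {0..1}"
  have B: "B \<in> sets unit_lebesgue" by (intro borel_subset_in_sets_unit_lebesgue) (auto simp: B_def)
  have pre: "f -` B \<inter> space unit_lebesgue \<in> sets unit_lebesgue"
    by (rule measurable_sets[OF f_measurable B])
  have "(\<Sum>t\<in>T. measure unit_lebesgue (piece m c t)) = measure unit_lebesgue (\<Union>t\<in>T. piece m c t)"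
    using finite_T piece_measurable
    by (intro L.finite_measure_finite_Union[symmetric]) (auto simp: disjoint_family_on_def piece_def)
  also have "\<dots> \<le> measure unit_lebesgue (f -` B \<inter> space unit_lebesgue)"
  proof (rule L.finite_measure_mono[OF _ pre], rule UN_least)
    fix t assume "t \<in> T"
    show "piece m c t \<subseteq> f -` B \<inter> space unit_lebesgue"
    proof
      fix x assume x: "x \<in> piece m c t"
      then have "f x \<in> {0..1}" using f_in_unit by (auto simp: piece_def)
      moreover have "real c / real m \<le> f x \<and> f x < (real c + 1) / real m"
        using cell_eq_iff[OF m, of "f x" c] x \<open>f x \<in> {0..1}\<close> by (auto simp: piece_def)
      ultimately show "x \<in> f -` B \<inter> space unit_lebesgue"
        using x by (auto simp: B_def piece_def)
    qed
  qed
  also have "\<dots> = measure unit_lebesgue B"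
    using preserving measure_distr[OF f_measurable B] by (simp add: lebesgue_preserving_def)
  also have "\<dots> \<le> 1 / real m"
  proof -
    have "emeasure lborel B \<le> emeasure lborel {real c / real m..(real c + 1) / real m}"
      by (intro emeasure_mono) (auto simp: B_def)
    also have "\<dots> = ennreal ((real c + 1) / real m - real c / real m)"
      using m by (intro emeasure_lborel_Icc) (simp add: divide_right_mono)
    also have "(real c + 1) / real m - real c / real m = 1 / real m"
      by (simp add: diff_divide_distrib[symmetric])
    finally have "emeasure unit_lebesgue B \<le> ennreal (1 / real m)"
      by (simp only: emeasure_unit_lebesgue[OF B])
    then show ?thesis by (simp add: L.emeasure_eq_measure)
  qed
  finally show ?thesis using m by (simp add: field_simps)
qed

lemma isCont_jac:
  assumes t: "t \<in> T" and x: "x \<in> U t"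
  shows "isCont jac x"
proof -
  have "continuous_on (U t) (\<lambda>x. \<bar>deriv f x\<bar>)" by (intro continuous_intros continuous_deriv[OF t])
  then have "continuous_on (U t) jac"
    by (rule continuous_on_cong[THEN iffD1, rotated -1]) (use t in \<open>auto simp: jac_def\<close>)
  then show ?thesis using U_open[OF t] x by (simp add: continuous_on_eq_continuous_at)
qed

text \<open>
  Once the cell around \<open>f x\<close> lies inside the image of the branch, the piece is, up to a null set, an
  interval mapped onto the cell, so the mean value theorem gives its length.
\<close>
lemma measure_piece_mean_value:
  assumes m: "m > 0" and t: "t \<in> T" and x: "x \<in> U t"
    and sub: "cball (f x) (1 / real m) \<subseteq> f ` U t"
  shows "\<exists>z. \<bar>z - x\<bar> \<le> 1 / real m \<and>
    real m * measure unit_lebesgue (piece m (cell m (f x)) t) = 1 / jac z"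
proof -
  interpret L: prob_space unit_lebesgue by (rule prob_space_unit_lebesgue)
  define c where "c = cell m (f x)"
  have x01: "x \<in> {0..1}" using U_subset[OF t] x by auto
  have c: "real c / real m \<le> f x" "f x < (real c + 1) / real m"
    using cell_eq_iff[OF m, of "f x" c] f_in_unit[OF x01] by (auto simp: c_def)
  have width: "(real c + 1) / real m - real c / real m = 1 / real m"
    by (simp add: diff_divide_distrib[symmetric])
  have "real c / real m \<in> f ` U t" "(real c + 1) / real m \<in> f ` U t"
    using c width by (auto intro!: subsetD[OF sub] simp: dist_real_def)
  then obtain p q where p: "p \<in> U t" "f p = real c / real m" and q: "q \<in> U t" "f q = (real c + 1) / real m"
    by (metis imageE)
  have fpq: "f p < f q" using width m by (simp add: p q divide_strict_right_mono)
  have in_piece: "y \<in> piece m c t \<longleftrightarrow> y \<in> U t \<and> \<not> f y < f p \<and> f y < f q" if "y \<in> branches" for y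
  proof -
    have "y \<in> {0..1}" using that U_subset by (meson UN_E subsetD)
    moreover have "label y = t \<longleftrightarrow> y \<in> U t" using that label_eq t in_U_label by blast
    ultimately show ?thesis
      using cell_eq_iff[OF m, of "f y" c] f_in_unit[of y] by (auto simp: piece_def p q)
  qed
  have between: "y \<in> U t" if "a \<in> U t" "b \<in> U t" "a \<le> y" "y \<le> b" for a b y
    using U_interval[OF t] that by (meson is_interval_1)
  \<comment> \<open>\<open>I\<close> is the interval between \<open>p\<close> and \<open>q\<close>, closed at the end that \<open>f\<close> maps to the left
    end of the cell\<close>
  define I where "I = (if t \<in> decreasing then {q<..p} else {p..<q})"
  have I: "y \<in> I \<longleftrightarrow> y \<in> U t \<and> \<not> f y < f p \<and> f y < f q" for y
  proof (cases "y \<in> U t")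
    case True
    then show ?thesis
      using f_less_iff[OF t True p(1)] f_less_iff[OF t True q(1)] by (auto simp: I_def)
  next
    case False
    then show ?thesis using between[OF p(1) q(1)] between[OF q(1) p(1)] by (auto simp: I_def)
  qed
  have I_sub: "I \<subseteq> U t" using I by blast
  then have Im: "I \<in> sets unit_lebesgue"
    using U_subset[OF t] by (intro borel_subset_in_sets_unit_lebesgue) (auto simp: I_def)
  have "AE y in unit_lebesgue. y \<in> piece m c t \<longleftrightarrow> y \<in> I"
    using AE_in_branches by eventually_elim (simp only: in_piece I)
  then have "measure unit_lebesgue (piece m c t) = measure unit_lebesgue I"
    using Im piece_measurable[OF t] by (intro L.finite_measure_eq_AE)
  also have "\<dots> = measure lborel I"
    by (simp add: measure_def emeasure_unit_lebesgue[OF Im])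
  also have "\<dots> = \<bar>q - p\<bar>"
    using fpq f_less_iff[OF t p(1) q(1)] by (auto simp: I_def)
  finally have meas: "measure unit_lebesgue (piece m c t) = \<bar>q - p\<bar>" .
  have xI: "x \<in> I" using x c by (simp add: I p q)
  obtain z where z: "z \<in> U t" "\<bar>z - x\<bar> \<le> \<bar>q - p\<bar>" "f q - f p = (q - p) * deriv f z"
  proof (cases "t \<in> decreasing")
    case True
    then have "q < p" using fpq f_less_iff(2)[OF t p(1) q(1)] by simp
    then obtain z where "z \<in> U t" "q < z" "z < p" "f p - f q = (p - q) * deriv f z"
      using mean_value[OF t q(1) p(1)] by blast
    then show ?thesis using xI True by (intro that[of z]) (auto simp: I_def algebra_simps)
  next
    case False
    then have "p < q" using fpq f_less_iff(1)[OF t p(1) q(1)] by simp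
    then obtain z where "z \<in> U t" "p < z" "z < q" "f q - f p = (q - p) * deriv f z"
      using mean_value[OF t p(1) q(1)] by blast
    then show ?thesis using xI False by (intro that[of z]) (auto simp: I_def)
  qed
  have jz: "jac z = \<bar>deriv f z\<bar>" using z(1) t by (auto simp: jac_def)
  have eq: "1 / real m = \<bar>q - p\<bar> * jac z"
    using arg_cong[OF z(3), of abs] fpq width by (simp add: p q abs_mult jz)
  have "\<bar>q - p\<bar> * 1 \<le> \<bar>q - p\<bar> * jac z" using jac_ge_1 by (intro mult_left_mono) auto
  then have "\<bar>z - x\<bar> \<le> 1 / real m" using z(2) eq by simp
  moreover have "real m * \<bar>q - p\<bar> = 1 / jac z"
    using eq m jac_ge_1[of z] by (simp add: field_simps)
  ultimately show ?thesis using meas by (auto simp: c_def)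
qed

lemma measure_piece_tendsto:
  assumes t: "t \<in> T" and x: "x \<in> U t"
  shows "(\<lambda>m. real m * measure unit_lebesgue (piece m (cell m (f x)) t)) \<longlonglongrightarrow> 1 / jac x"
proof -
  define g where "g m = real m * measure unit_lebesgue (piece m (cell m (f x)) t)" for m
  have "f x \<in> f ` U t" using x by blast
  then obtain e where e: "e > 0" "cball (f x) e \<subseteq> f ` U t"
    using open_image[OF t U_open[OF t] order_refl] open_contains_cball by blast
  have small: "eventually (\<lambda>m. 1 / real m < e) sequentially"
    using lim_1_over_n e(1) by (rule order_tendstoD)
  have ev: "eventually (\<lambda>m. \<exists>z. \<bar>z - x\<bar> \<le> 1 / real m \<and> g m = 1 / jac z) sequentially"
    using small eventually_gt_at_top[of 0]
  proof eventually_elim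
    case (elim m)
    have "cball (f x) (1 / real m) \<subseteq> f ` U t"
      using e(2) elim by (intro order_trans[OF subset_cball e(2)]) simp
    then show ?case unfolding g_def using elim by (intro measure_piece_mean_value t x) auto
  qed
  define z where "z m = (SOME z. \<bar>z - x\<bar> \<le> 1 / real m \<and> g m = 1 / jac z)" for m
  have z: "eventually (\<lambda>m. \<bar>z m - x\<bar> \<le> 1 / real m \<and> g m = 1 / jac (z m)) sequentially"
    using ev by eventually_elim (unfold z_def, rule someI_ex)
  have "(\<lambda>m. z m - x) \<longlonglongrightarrow> 0"
    by (rule Lim_null_comparison[OF _ lim_1_over_n]) (use z in \<open>auto elim: eventually_mono\<close>)
  then have "z \<longlonglongrightarrow> x" by (simp add: LIM_zero_iff)
  then have "(\<lambda>m. jac (z m)) \<longlonglongrightarrow> jac x"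
    by (rule isCont_tendsto_compose[OF isCont_jac[OF t x]])
  then have "(\<lambda>m. 1 / jac (z m)) \<longlonglongrightarrow> 1 / jac x"
    using jac_ge_1[of x] by (intro tendsto_divide tendsto_const) auto
  moreover have "eventually (\<lambda>m. 1 / jac (z m) = g m) sequentially"
    using z by eventually_elim simp
  ultimately have "g \<longlonglongrightarrow> 1 / jac x" by (rule Lim_transform_eventually)
  then show ?thesis by (simp add: g_def [abs_def])
qed

text \<open>
  The conditional probability of branch \<open>t\<close> given cell \<open>c\<close>, mixed with a little of the uniform
  distribution, which keeps its logarithm bounded.
\<close>
definition weight :: "nat \<Rightarrow> real \<Rightarrow> nat \<Rightarrow> real \<Rightarrow> real" where
  "weight m \<delta> c t =
    (real m * measure unit_lebesgue (piece m c t) + \<delta>) / (1 + real (card T) * \<delta>)"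

lemma weight_pos: "0 < \<delta> \<Longrightarrow> 0 < weight m \<delta> c t"
  unfolding weight_def
  by (intro divide_pos_pos add_nonneg_pos add_pos_nonneg mult_nonneg_nonneg) auto

lemma sum_weight_le:
  assumes "m > 0" "0 < \<delta>"
  shows "(\<Sum>t\<in>T. weight m \<delta> c t) \<le> 1"
proof -
  have d: "0 < 1 + real (card T) * \<delta>" using assms(2) by (intro add_pos_nonneg) auto
  have "(\<Sum>t\<in>T. weight m \<delta> c t)
      = (real m * (\<Sum>t\<in>T. measure unit_lebesgue (piece m c t)) + real (card T) * \<delta>) / (1 + real (card T) * \<delta>)"
    by (simp add: weight_def sum_divide_distrib[symmetric] sum.distrib sum_distrib_left)
  also have "\<dots> \<le> 1" using sum_measure_piece_le[OF assms(1), of c] d by simp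
  finally show ?thesis .
qed

text \<open>
  The conditional probabilities converge to \<open>1 / jac x\<close> for almost every \<open>x\<close>, and the logarithms
  of the weights are bounded because the weights lie between \<open>\<delta> / D\<close> and \<open>(1 + \<delta>) / D\<close>.
\<close>
lemma weight_tendsto:
  assumes \<delta>: "0 < \<delta>"
  shows "(\<lambda>m. \<integral>x. - ln (weight m \<delta> (cell m (f x)) (label x)) \<partial>unit_lebesgue)
    \<longlonglongrightarrow> (\<integral>x. - ln ((1 / jac x + \<delta>) / (1 + real (card T) * \<delta>)) \<partial>unit_lebesgue)"
proof -
  interpret L: prob_space unit_lebesgue by (rule prob_space_unit_lebesgue)
  define D where "D = 1 + real (card T) * \<delta>"
  have D: "0 < D" using \<delta> unfolding D_def by (intro add_pos_nonneg) auto
  define \<phi> where "\<phi> m x = - ln (weight m \<delta> (cell m (f x)) (label x))" for m x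
  have \<phi>_m: "\<phi> m \<in> borel_measurable unit_lebesgue" for m
  proof -
    have "(\<lambda>x. (\<lambda>(c, t). - ln (weight m \<delta> c t)) (cell m (f x), label x)) \<in> borel_measurable unit_lebesgue"
      by (rule measurable_compose[OF cell_label_measurable]) simp
    then show ?thesis by (simp add: \<phi>_def [abs_def])
  qed
  have "(\<lambda>m. \<integral>x. \<phi> m x \<partial>unit_lebesgue) \<longlonglongrightarrow> (\<integral>x. - ln ((1 / jac x + \<delta>) / D) \<partial>unit_lebesgue)"
  proof (rule integral_dominated_convergence[where w = "\<lambda>_. \<bar>ln (\<delta> / D)\<bar> + \<bar>ln ((1 + \<delta>) / D)\<bar>"])
    show "(\<lambda>x. - ln ((1 / jac x + \<delta>) / D)) \<in> borel_measurable unit_lebesgue"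
      by measurable
    show "AE x in unit_lebesgue. (\<lambda>m. \<phi> m x) \<longlonglongrightarrow> - ln ((1 / jac x + \<delta>) / D)"
      using AE_in_branches
    proof eventually_elim
      case (elim x)
      have pos: "0 < (1 / jac x + \<delta>) / D"
        using jac_ge_1[of x] \<delta> D by (intro divide_pos_pos add_nonneg_pos) auto
      have "(\<lambda>m. weight m \<delta> (cell m (f x)) (label x)) \<longlonglongrightarrow> (1 / jac x + \<delta>) / D"
        unfolding weight_def D_def[symmetric] using D
        by (intro tendsto_divide tendsto_add tendsto_const
            measure_piece_tendsto[OF label_in_T in_U_label[OF elim]]) auto
      then show ?case unfolding \<phi>_def using pos by (intro tendsto_minus tendsto_ln) auto
    qed
    fix m
    show "AE x in unit_lebesgue. norm (\<phi> m x) \<le> \<bar>ln (\<delta> / D)\<bar> + \<bar>ln ((1 + \<delta>) / D)\<bar>"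
    proof (rule AE_I2)
      fix x
      define r where "r = real m * measure unit_lebesgue (piece m (cell m (f x)) (label x))"
      have r: "0 \<le> r" by (simp add: r_def)
      have "r \<le> 1"
      proof (cases "m > 0")
        case True
        have "measure unit_lebesgue (piece m (cell m (f x)) (label x))
            \<le> (\<Sum>t\<in>T. measure unit_lebesgue (piece m (cell m (f x)) t))"
          using finite_T label_in_T by (intro member_le_sum) auto
        then have "r \<le> real m * (\<Sum>t\<in>T. measure unit_lebesgue (piece m (cell m (f x)) t))"
          unfolding r_def by (intro mult_left_mono) auto
        then show ?thesis using sum_measure_piece_le[OF True, of "cell m (f x)"] by simp
      qed (simp add: r_def)
      have w: "weight m \<delta> (cell m (f x)) (label x) = (r + \<delta>) / D"
        by (simp add: weight_def r_def D_def)
      have "ln (\<delta> / D) \<le> ln ((r + \<delta>) / D)" "ln ((r + \<delta>) / D) \<le> ln ((1 + \<delta>) / D)"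
        using r \<open>r \<le> 1\<close> \<delta> D by (auto simp: divide_right_mono)
      then show "norm (\<phi> m x) \<le> \<bar>ln (\<delta> / D)\<bar> + \<bar>ln ((1 + \<delta>) / D)\<bar>"
        unfolding \<phi>_def w real_norm_def by linarith
    qed
  qed (use \<phi>_m in auto)
  then show ?thesis by (simp add: \<phi>_def D_def)
qed

lemma limit_weight_le:
  assumes \<delta>: "0 < \<delta>"
  shows "(\<integral>x. - ln ((1 / jac x + \<delta>) / (1 + real (card T) * \<delta>)) \<partial>unit_lebesgue)
    \<le> (\<integral>x. ln (jac x) \<partial>unit_lebesgue) + real (card T) * \<delta>"
proof -
  interpret L: prob_space unit_lebesgue by (rule prob_space_unit_lebesgue)
  define D where "D = 1 + real (card T) * \<delta>"
  have D: "1 \<le> D" using \<delta> by (simp add: D_def)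
  have upper: "- ln ((1 / jac x + \<delta>) / D) \<le> ln (jac x) + real (card T) * \<delta>" for x
  proof -
    have j: "0 < jac x" using jac_ge_1[of x] by simp
    have "ln (1 / jac x) \<le> ln (1 / jac x + \<delta>)"
      using j \<delta> by (subst ln_le_cancel_iff) (auto intro: add_pos_pos)
    moreover have "ln D \<le> D - 1" using D by (intro ln_le_minus_one) simp
    moreover have "0 < 1 / jac x + \<delta>" using j \<delta> by (simp add: add_pos_pos)
    ultimately show ?thesis using j D by (simp add: ln_div D_def)
  qed
  have lower: "- ln ((1 / jac x + \<delta>) / D) \<ge> - ln (1 + \<delta>)" for x
  proof -
    have j: "0 < 1 / jac x" "1 / jac x \<le> 1" using jac_ge_1[of x] by auto
    have "(1 / jac x + \<delta>) / D \<le> 1 / jac x + \<delta>"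
      using j \<delta> D divide_left_mono[of 1 D "1 / jac x + \<delta>"] by simp
    also have "\<dots> \<le> 1 + \<delta>" using j(2) by (rule add_right_mono)
    finally have "(1 / jac x + \<delta>) / D \<le> 1 + \<delta>" .
    moreover have "0 < (1 / jac x + \<delta>) / D"
      using D by (intro divide_pos_pos add_pos_pos j(1) \<delta>) simp
    ultimately have "ln ((1 / jac x + \<delta>) / D) \<le> ln (1 + \<delta>)"
      using \<delta> by (subst ln_le_cancel_iff) auto
    then show ?thesis by simp
  qed
  have "integrable unit_lebesgue (\<lambda>x. - ln ((1 / jac x + \<delta>) / D))"
  proof (rule Bochner_Integration.integrable_bound)
    show "integrable unit_lebesgue (\<lambda>x. ln (jac x) + real (card T) * \<delta> + ln (1 + \<delta>))"
      using integrable_ln_jac by simp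
    show "AE x in unit_lebesgue. norm (- ln ((1 / jac x + \<delta>) / D))
        \<le> norm (ln (jac x) + real (card T) * \<delta> + ln (1 + \<delta>))"
    proof (rule AE_I2)
      fix x
      have "0 \<le> ln (jac x)" "0 \<le> ln (1 + \<delta>)" "0 \<le> real (card T) * \<delta>" using jac_ge_1[of x] \<delta> by auto
      then show "norm (- ln ((1 / jac x + \<delta>) / D)) \<le> norm (ln (jac x) + real (card T) * \<delta> + ln (1 + \<delta>))"
        using upper[of x] lower[of x] unfolding real_norm_def by linarith
    qed
  qed measurable
  then have "(\<integral>x. - ln ((1 / jac x + \<delta>) / D) \<partial>unit_lebesgue)
      \<le> (\<integral>x. ln (jac x) + real (card T) * \<delta> \<partial>unit_lebesgue)"
    using integrable_ln_jac upper by (intro integral_mono) auto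
  also have "\<dots> = (\<integral>x. ln (jac x) \<partial>unit_lebesgue) + real (card T) * \<delta>"
    using integrable_ln_jac L.prob_space by simp
  finally show ?thesis by (simp add: D_def)
qed

section \<open>The entropy rate\<close>

text \<open>
  For the upper bound the grid \<open>m\<close> and the perturbation \<open>\<delta>\<close> are fixed before \<open>n\<close> grows, so the
  monotone words of cells cost only \<open>O(ln n)\<close>.
\<close>
theorem entropy_rate:
  "(\<lambda>n. permuton_entropy n (permuton_of f) / real n) \<longlonglongrightarrow> (\<integral>x. ln (jac x) \<partial>unit_lebesgue)"
proof (rule order_tendstoI)
  define h where "h = (\<integral>x. ln (jac x) \<partial>unit_lebesgue)"
  have log: "(\<lambda>n. C * (ln (real n + 1) / real n)) \<longlonglongrightarrow> 0" for C
  proof -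
    have "(\<lambda>n. ln (real (Suc n)) / real (Suc n) * (real (Suc n) / real n)) \<longlonglongrightarrow> 0 * 1"
      by (intro tendsto_mult LIMSEQ_Suc[OF lim_ln_over_n] LIMSEQ_Suc_n_over_n)
    then have "(\<lambda>n. ln (real n + 1) / real n) \<longlonglongrightarrow> 0"
      by (simp add: add.commute)
    then show ?thesis by (rule tendsto_mult_right_zero)
  qed
  fix a
  show "eventually (\<lambda>n. a < permuton_entropy n (permuton_of f) / real n) sequentially"
    if "a < (\<integral>x. ln (jac x) \<partial>unit_lebesgue)"
  proof -
    have "eventually (\<lambda>n. real (card T) * (ln (real n + 1) / real n) < h - a) sequentially"
      using that by (intro order_tendstoD(2)[OF log]) (simp add: h_def)
    then show ?thesis
      using eventually_gt_at_top[of 0]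
    proof eventually_elim
      case (elim n)
      then have "a * real n < real n * h - card T * ln (real n + 1)"
        by (simp add: field_simps)
      also have "\<dots> \<le> permuton_entropy n (permuton_of f)" unfolding h_def by (rule entropy_ge)
      finally show ?case using elim by (simp add: pos_less_divide_eq)
    qed
  qed
  show "eventually (\<lambda>n. permuton_entropy n (permuton_of f) / real n < a) sequentially"
    if "(\<integral>x. ln (jac x) \<partial>unit_lebesgue) < a"
  proof -
    have k: "0 < real (card T)" using finite_T T_nonempty by (simp add: card_gt_0_iff)
    \<comment> \<open>the perturbation raises the limit by at most \<open>card T * \<delta>\<close>, half of the available gap\<close>
    define \<delta> where "\<delta> = (a - h) / (2 * real (card T))"
    have \<delta>: "0 < \<delta>" using that k by (simp add: \<delta>_def h_def)
    define b where "b m = (\<integral>x. - ln (weight m \<delta> (cell m (f x)) (label x)) \<partial>unit_lebesgue)" for m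
    have "(\<integral>x. - ln ((1 / jac x + \<delta>) / (1 + real (card T) * \<delta>)) \<partial>unit_lebesgue) \<le> h + (a - h) / 2"
      using limit_weight_le[OF \<delta>] k by (simp add: h_def \<delta>_def)
    also have "\<dots> < a" using that by (simp add: h_def field_simps)
    finally have "eventually (\<lambda>m. b m < a) sequentially"
      unfolding b_def by (rule order_tendstoD(2)[OF weight_tendsto[OF \<delta>]])
    then have "eventually (\<lambda>m. b m < a \<and> m > 0) sequentially"
      using eventually_gt_at_top[of 0] by (rule eventually_conj)
    then obtain m where m: "b m < a" "m > 0" by (auto simp: eventually_sequentially)
    have "eventually (\<lambda>n. (real m + 1) * (ln (real n + 1) / real n) < a - b m) sequentially"
      using m by (intro order_tendstoD(2)[OF log]) simp
    then show ?thesis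
      using eventually_gt_at_top[of 0]
    proof eventually_elim
      case (elim n)
      have "permuton_entropy n (permuton_of f) \<le> (real m + 1) * ln (real n + 1) + real n * b m"
        unfolding b_def using weight_pos[OF \<delta>] sum_weight_le[OF m(2) \<delta>] by (intro entropy_le)
      also have "\<dots> < a * real n" using elim by (simp add: field_simps)
      finally show ?case using elim by (simp add: pos_divide_less_eq)
    qed
  qed
qed

end

text \<open>
  The nonempty interiors of the pieces are the branches; each is named by a point chosen in it.
\<close>
lemma branched_map_of_piecewise_C1:
  assumes "lebesgue_preserving f" and "finitely_piecewise_C1 f"
  obtains T U where "branched_map f T U"
proof -
  obtain P where P: "finite P" "partition_on {0..1} P"
      "\<And>I. I \<in> P \<Longrightarrow> is_interval I" "\<And>I. I \<in> P \<Longrightarrow> f C1_differentiable_on (interior I)"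
    using assms(2) unfolding finitely_piecewise_C1_def by blast
  define B where "B = interior ` P - {{}}"
  define name where "name V = (SOME t. t \<in> V)" for V :: "real set"
  have name: "name V \<in> V" if "V \<in> B" for V
    using that by (auto simp: name_def some_in_eq B_def)
  have B_interval: "is_interval V" "open V" "V \<subseteq> {0..1}" "f C1_differentiable_on V" if "V \<in> B" for V
  proof -
    have "V \<in> interior ` P" using that by (simp add: B_def)
    then obtain I where I: "I \<in> P" "V = interior I" by blast
    show "is_interval V" "open V" "f C1_differentiable_on V"
      using P(3,4)[OF I(1)] by (auto simp: I(2) is_interval_convex_1)
    show "V \<subseteq> {0..1}"
      using partition_onD1[OF P(2)] I interior_subset by blast
  qed
  have disj: "V = V'" if V: "V \<in> B" "V' \<in> B" "x \<in> V" "x \<in> V'" for V V' x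
  proof -
    have "V \<in> interior ` P" "V' \<in> interior ` P" using V by (simp_all add: B_def)
    then obtain I I' where "I \<in> P" "V = interior I" "I' \<in> P" "V' = interior I'" by blast
    then show ?thesis
      using partition_onD2[OF P(2)] V(3,4) interior_subset by (blast dest: disjointD)
  qed
  have inj: "inj_on name B"
    by (rule inj_onI) (metis disj name)
  define U where "U = inv_into B name"
  have U: "U t \<in> B" "name (U t) = t" if "t \<in> name ` B" for t
    using that by (auto simp: U_def inv_into_into f_inv_into_f)
  have cover: "(\<Union>t\<in>name ` B. U t) = \<Union>B"
    using inj by (auto simp: U_def)
  have "branched_map f (name ` B) U"
  proof
    show "finite (name ` B)" using P(1) by (simp add: B_def)
    fix t assume t: "t \<in> name ` B"
    show "open (U t)" "is_interval (U t)" "U t \<subseteq> {0..1}" "f C1_differentiable_on (U t)"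
      using B_interval[OF U(1)[OF t]] by auto
    show "t \<in> U t" using name[OF U(1)[OF t]] U(2)[OF t] by simp
    fix t' x x' assume t': "t' \<in> name ` B" "t < t'" and x: "x \<in> U t" "x' \<in> U t'"
    have n: "t \<in> U t" "t' \<in> U t'"
      using name[OF U(1)[OF t]] U(2)[OF t] name[OF U(1)[OF t'(1)]] U(2)[OF t'(1)] by auto
    have ne: "y \<notin> U t'" if "y \<in> U t" for y
      using disj[OF U(1)[OF t] U(1)[OF t'(1)] that] U(2)[OF t] U(2)[OF t'(1)] t'(2) by auto
    have "is_interval (U t)" "is_interval (U t')"
      using B_interval(1)[OF U(1)[OF t]] B_interval(1)[OF U(1)[OF t'(1)]] .
    then show "x < x'"
      using ne[OF x(1)] ne[OF n(1)] n x t'(2) ne unfolding is_interval_1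
      by (metis linorder_not_less order.strict_implies_order order_trans nle_le)
  next
    have "{0..1} - \<Union>B \<subseteq> (\<Union>I\<in>P. I - interior I)"
      using partition_onD1[OF P(2)] by (auto simp: B_def)
    moreover have "finite (I - interior I)" if "I \<in> P" for I
    proof -
      have "I \<subseteq> {0..1}" using partition_onD1[OF P(2)] that by blast
      then have bdd: "bounded I" by (rule bounded_subset[OF bounded_closed_interval])
      \<comment> \<open>an interval differs from its interior at most in its endpoints\<close>
      have "I - interior I \<subseteq> {Inf I, Sup I}"
      proof
        fix x assume x: "x \<in> I - interior I"
        show "x \<in> {Inf I, Sup I}"
        proof (rule ccontr)
          assume "x \<notin> {Inf I, Sup I}"
          moreover have "Inf I \<le> x" "x \<le> Sup I"
            using x bdd by (auto intro!: cInf_lower cSup_upper bounded_imp_bdd_above bounded_imp_bdd_below)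
          ultimately have "Inf I < x" "x < Sup I" by auto
          moreover have "I \<noteq> {}" using x by blast
          ultimately obtain a b where ab: "a \<in> I" "a < x" "b \<in> I" "x < b"
            using cInf_lessD less_cSupD by metis
          then have "{a<..<b} \<subseteq> I"
            using P(3)[OF that] unfolding is_interval_1 by (meson greaterThanLessThan_iff less_imp_le subsetI)
          then have "x \<in> interior I" using ab by (intro interiorI[of "{a<..<b}"]) auto
          then show False using x by simp
        qed
      qed
      then show ?thesis by (rule finite_subset) simp
    qed
    ultimately show "finite ({0..1} - (\<Union>t\<in>name ` B. U t))"
      unfolding cover using P(1) by (meson finite_UN_I finite_subset)
  qed (rule assms(1))
  then show ?thesis by (rule that)
qed

theorem theorem1p2:
  fixes f :: "real \<Rightarrow> real"
  assumes "lebesgue_preserving f" and "finitely_piecewise_C1 f"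
  shows "integrable unit_lebesgue (\<lambda>x. ln \<bar>deriv f x\<bar>) \<and>
    (\<lambda>n. permuton_entropy n (permuton_of f) / real n)
      \<longlonglongrightarrow> (\<integral>x. ln \<bar>deriv f x\<bar> \<partial>unit_lebesgue)"
proof -
  obtain T U where "branched_map f T U"
    using branched_map_of_piecewise_C1[OF assms] .
  then interpret branched_map f T U .
  show ?thesis
    using integrable_ln_abs_deriv(1) entropy_rate unfolding integrable_ln_abs_deriv(2) by blast
qed

end
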